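(* Let $n\ge1$. For all partitions $\mu,\lambda\in\mathcal{P}_{n}$, \[ B(\mu,\lambda)=(-1)^{\lambda_1-\mu_1}\left\{\binom{\lambda_1-\mu_2}{\mu_1-\mu_2}\left\langle{(\mu_2,\mu_3,\ldots)\atop(\lambda_2,\lambda_3,\ldots)}\right\rangle+\binom{\lambda_1-\mu_2-1}{\mu_1-\mu_2}\left\langle{(\mu_2-1,\mu_3,\ldots)^{+}\atop(\lambda_2,\lambda_3,\ldots)}\right\rangle\right\}. \]
   Context: $\mathbb{N}_0=\{0,1,2,\ldots\}$. A partition is a finite sequence $\lambda=(\lambda_1,\lambda_2,\ldots)$ of nonnegative integers with $\lambda_1\ge\lambda_2\ge\cdots\ge0$; partitions with the same nonzero components are identified (so $\lambda_i=0$ for $i$ beyond the length). $|\lambda|=\sum_i\lambda_i$, $l(\lambda)=\#\{i:\lambda_i\ge1\}$, and $\mathcal{P}_n$ is the set of partitions with $|\lambda|=n$. For a finite sequence $\alpha$ of nonnegative integers, $\alpha^+$ is the partition obtained by sorting the components in nonincreasing order. Let $N$ be a number of variables not less than the length of any partition that appears (e.g. $N\ge n$). $x^\alpha=\prod_{i=1}^N x_i^{\alpha_i}$, $m_\lambda=\sum\{x^\alpha:\alpha\in\mathbb{N}_0^N,\alpha^+=\lambda\}$ is the monomial symmetric function, $e_1=\sum_{i=1}^N x_i$, and $\widetilde m_\lambda=e_1^{\lambda_1-\lambda_2}m_{(\lambda_2,\lambda_2,\lambda_3,\ldots)}$. The set $\{\widetilde m_\lambda:\lambda\in\mathcal{P}_n\}$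 is a basis of the homogeneous symmetric polynomials of degree $n$ in $N\ge n$ variables, and the transition matrix $B(\mu,\lambda)$, for $|\lambda|=|\mu|$, is defined by $m_\lambda=\sum_\mu B(\mu,\lambda)\widetilde m_\mu$ (its entries do not depend on $N$). The coefficient $\left\langle{\lambda\atop\nu}\right\rangle$ for partitions $\lambda,\nu$ is defined by the expansion $e_1^{j}m_\nu=\sum_{|\lambda|=|\nu|+j}\left\langle{\lambda\atop\nu}\right\rangle m_\lambda$ for $j=0,1,2,\ldots$ (it does not depend on $N$), and is $0$ if $|\lambda|<|\nu|$. Conventions: $\binom{-1}{m}=0$ for all $m\ge0$ (including $m=0$), and $\binom{a}{b}=0$ for integers $0\le a<b$. A product in which the coefficient $\langle\cdot\rangle$ vanishes is $0$. If $\mu_2=0$ (so $\mu=(n)$) the second term is $0$, its binomial coefficient being $\binom{\lambda_1-1}{n}=0$. *)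

theory Defs
  imports Complex_Main "HOL-Library.Poly_Mapping"
begin

text \<open>A partition is represented by the list of its nonzero parts in nonincreasing order, so that
  partitions differing by trailing zeros are identified. Polynomials are elements of
  \<open>(nat \<Rightarrow>\<^sub>0 nat) \<Rightarrow>\<^sub>0 'a\<close>: finitely supported coefficient functions on finitely supported exponent
  vectors. The variables \<open>x\<^sub>1, \<dots>, x\<^sub>N\<close> are numbered \<open>0, \<dots>, N - 1\<close>.\<close>

definition partitions :: "nat \<Rightarrow> nat list set" where
  "partitions n = {lam. sorted_wrt (\<ge>) lam \<and> 0 \<notin> set lam \<and> sum_list lam = n}"

text \<open>The parts are counted from 1, and are 0 beyond the length.\<close>

definition part :: "nat list \<Rightarrow> nat \<Rightarrow> nat" where
  "part lam i = (if 1 \<le> i \<and> i \<le> length lam then lam ! (i - 1) else 0)"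

text \<open>The partition \<open>\<alpha>\<^sup>+\<close> of a finite sequence \<open>\<alpha>\<close>.\<close>

definition sort_desc :: "nat list \<Rightarrow> nat list" where
  "sort_desc \<alpha> = rev (sort (filter (\<lambda>a. a \<noteq> 0) \<alpha>))"

type_synonym 'a mpoly = "(nat \<Rightarrow>\<^sub>0 nat) \<Rightarrow>\<^sub>0 'a"

definition Var :: "nat \<Rightarrow> 'a::comm_ring_1 mpoly" where
  "Var i = Poly_Mapping.single (Poly_Mapping.single i 1) 1"

definition Const :: "'a::comm_ring_1 \<Rightarrow> 'a mpoly" where
  "Const c = Poly_Mapping.single 0 c"

definition e1 :: "nat \<Rightarrow> 'a::comm_ring_1 mpoly" where
  "e1 N = (\<Sum>i<N. Var i)"

definition msym :: "nat \<Rightarrow> nat list \<Rightarrow> 'a::comm_ring_1 mpoly" where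
  "msym N lam = (\<Sum>\<alpha> | length \<alpha> = N \<and> sort_desc \<alpha> = lam. \<Prod>i<N. Var i ^ (\<alpha> ! i))"

text \<open>For a partition \<open>lam\<close>, the index of the monomial function is \<open>(lam\<^sub>2, lam\<^sub>2, lam\<^sub>3, \<dots>)\<close>; the sorting
  only removes the zero in the case \<open>lam\<^sub>2 = 0\<close>.\<close>

definition mtilde :: "nat \<Rightarrow> nat list \<Rightarrow> 'a::comm_ring_1 mpoly" where
  "mtilde N lam = e1 N ^ (part lam 1 - part lam 2) * msym N (sort_desc (part lam 2 # tl lam))"

text \<open>The coefficients of an expansion, being independent of \<open>N\<close>, are specified by requiring the
  expansion for all admissible \<open>N\<close>; they are 0 outside the index set of the expansion.\<close>

definition trans_mat :: "nat list \<Rightarrow> nat list \<Rightarrow> 'a::comm_ring_1" where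
  "trans_mat \<mu> lam = (THE c.
     (\<forall>\<kappa>. \<kappa> \<notin> partitions (sum_list lam) \<longrightarrow> c \<kappa> = 0) \<and>
     (\<forall>N \<ge> sum_list lam.
        msym N lam = (\<Sum>\<kappa> \<in> partitions (sum_list lam). Const (c \<kappa>) * mtilde N \<kappa>))) \<mu>"

text \<open>\<open>e1_coeff lam \<nu>\<close> is the coefficient of \<open>msym N lam\<close> in \<open>e1 N ^ j * msym N \<nu>\<close>, where \<open>j = |lam| - |\<nu>|\<close>.\<close>

definition e1_coeff :: "nat list \<Rightarrow> nat list \<Rightarrow> 'a::comm_ring_1" where
  "e1_coeff lam \<nu> = (if sum_list lam < sum_list \<nu> then 0 else (THE c.
     (\<forall>\<kappa>. \<kappa> \<notin> partitions (sum_list lam) \<longrightarrow> c \<kappa> = 0) \<and>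
     (\<forall>N \<ge> sum_list lam.
        e1 N ^ (sum_list lam - sum_list \<nu>) * msym N \<nu> =
          (\<Sum>\<kappa> \<in> partitions (sum_list lam). Const (c \<kappa>) * msym N \<kappa>))) lam)"

text \<open>Binomial coefficient that vanishes for a negative upper argument; the library's
  \<open>gchoose\<close> has \<open>-1 gchoose m = (-1)\<^sup>m\<close>.\<close>

definition binom :: "int \<Rightarrow> nat \<Rightarrow> nat" where
  "binom a b = (if a < 0 then 0 else nat a choose b)"

end

theory Submission imports Defs "HOL-Library.Multiset" begin

text \<open>A symmetric polynomial is determined by its coefficient function, which lives on multisets of
  nonzero exponents; multiplication by \<open>e\<^sub>1\<close> becomes an operator \<open>U\<close> (\<open>pieri\<close>) that lowers one part
  at a time. Let \<open>R\<^sub>a\<close> (\<open>remove_top\<close>) adjoin a largest part \<open>a\<close> to the index, so that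
  \<open>R\<^sub>a m\<^sub>\<nu> = m\<^bsub>(a,\<nu>)\<^esub>\<close> if \<open>\<nu>\<^sub>1 \<le> a\<close> and \<open>0\<close> otherwise, let \<open>D\<^sub>a\<close> (\<open>remove_double_top\<close>) be \<open>R\<^sub>a\<close>
  restricted to the indices \<open>(a, \<rho>)\<close> with \<open>\<rho>\<^sub>1 = a\<close>, and let \<open>D'\<^sub>a\<close> (\<open>lower_double_top\<close>) be the variant of
  \<open>D\<^sub>a\<close> that reads the argument at \<open>(\<rho>\<^sub>1 - 1, \<rho>\<^sub>2, \<dots>)\<^sup>+\<close> instead of \<open>\<rho>\<close>. Then
  \<open>U R\<^sub>a - R\<^sub>a U = R\<^bsub>a+1\<^esub> + D'\<^sub>a - D\<^bsub>a+1\<^esub>\<close> and \<open>R\<^sub>0 = D\<^sub>0\<close>. With \<open>ad X = U X - X U\<close> this solves to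
  \<open>R\<^sub>a = \<Sum>\<^bsub>r\<le>a\<^esub> ad\<^bsup>a-r\<^esup> D\<^sub>r - \<Sum>\<^bsub>r<a\<^esub> ad\<^bsup>a-1-r\<^esup> D'\<^sub>r\<close>. The binomial expansion of the powers of \<open>ad\<close>,
  applied to \<open>m\<^sub>\<nu>\<close> with \<open>\<nu> = (\<lambda>\<^sub>2, \<lambda>\<^sub>3, \<dots>)\<close> and \<open>a = \<lambda>\<^sub>1\<close>, expands \<open>m\<^sub>\<lambda>\<close> as claimed, and the coefficients
  are unique because the \<open>mtilde\<close> are unitriangular with respect to the first part.\<close>

subsection \<open>Operators on coefficient functions\<close>

text \<open>A lowered part 1 disappears, so zero-free multisets stay zero-free; a part 0 stays 0 by
  truncated subtraction, so multisets containing 0 never become zero-free.\<close>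

definition dec_part :: "nat \<Rightarrow> nat multiset \<Rightarrow> nat multiset" where
  "dec_part x M = (M - {#x#}) + (if x = 1 then {#} else {#x - 1#})"

text \<open>Multiplication by e_1 on coefficient functions. Equal parts count with multiplicity
  because they are exponents of different variables.\<close>

definition pieri :: "(nat multiset \<Rightarrow> 'a::comm_ring_1) \<Rightarrow> nat multiset \<Rightarrow> 'a" where
  "pieri f M = (\<Sum>x\<in>#M. f (dec_part x M))"

text \<open>The top part of the empty multiset is 0.\<close>

definition is_top :: "nat \<Rightarrow> nat multiset \<Rightarrow> bool" where
  "is_top a M \<longleftrightarrow> 0 \<notin># M \<and> (\<forall>x\<in>#M. x \<le> a) \<and> (a = 0 \<or> a \<in># M)"

definition remove_top :: "nat \<Rightarrow> (nat multiset \<Rightarrow> 'a::comm_ring_1) \<Rightarrow> nat multiset \<Rightarrow> 'a" where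
  "remove_top a h M = (if is_top a M then h (M - {#a#}) else 0)"

definition remove_double_top :: "nat \<Rightarrow> (nat multiset \<Rightarrow> 'a::comm_ring_1) \<Rightarrow> nat multiset \<Rightarrow> 'a" where
  "remove_double_top a h M = (if is_top a M \<and> is_top a (M - {#a#}) then h (M - {#a#}) else 0)"

definition lower_double_top :: "nat \<Rightarrow> (nat multiset \<Rightarrow> 'a::comm_ring_1) \<Rightarrow> nat multiset \<Rightarrow> 'a" where
  "lower_double_top a h M = (if a > 0 \<and> is_top a M \<and> is_top a (M - {#a#})
     then h (dec_part a (M - {#a#})) else 0)"

lemma is_top_0 [simp]: "is_top 0 M \<longleftrightarrow> M = {#}"
  by (auto simp: is_top_def) (metis multiset_nonemptyE)

lemma dec_part_add: "x \<in># M \<Longrightarrow> dec_part x (add_mset a M) = add_mset a (dec_part x M)"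
  by (auto simp: dec_part_def)

lemma dec_part_same: "dec_part a (add_mset a M) = M + (if a = 1 then {#} else {#a - 1#})"
  by (simp add: dec_part_def)

lemma zero_mem_dec_part: "0 \<in># M \<Longrightarrow> 0 \<in># dec_part x M"
  by (cases "x = 0") (auto simp: dec_part_def in_diff_count)

lemma multiset_Max_cases:
  fixes M :: "nat multiset"
  assumes "0 \<notin># M"
  obtains "M = {#}" | b K where "b > 0" "M = add_mset b K" "0 \<notin># K" "\<forall>x\<in>#K. x \<le> b"
proof (cases "M = {#}")
  case False
  define b where "b = Max_mset M"
  have "b \<in># M" using False by (simp add: b_def)
  moreover have "\<forall>x\<in>#M. x \<le> b" by (simp add: b_def)
  ultimately show ?thesis using that(2)[of b "M - {#b#}"] assms
    by (metis gr0I in_diffD insert_DiffM)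
qed (use that in blast)

text \<open>Split one largest part b off M. Lowering any other part commutes with removing b, so
  these terms cancel and only the term that lowers b itself is left. It survives if a = b and
  another copy of b remains, which gives \<open>lower_double_top a\<close>, or if b = a + 1 occurs
  only once, which gives \<open>remove_top (Suc a)\<close> minus
  \<open>remove_double_top (Suc a)\<close>.\<close>

lemma commutator_pieri_remove_top:
  "pieri (remove_top a h) M - remove_top a (pieri h) M = remove_top (Suc a) h M + lower_double_top
    a h M - remove_double_top (Suc a) h M"
proof (cases "0 \<in># M")
  case True
  then have "\<not> is_top b M" for b by (simp add: is_top_def)
  moreover have "\<not> is_top b (dec_part x M)" for b x
    using zero_mem_dec_part[OF True] by (simp add: is_top_def)
  ultimately show ?thesis by (simp add: pieri_def remove_top_def remove_double_top_def
    lower_double_top_def)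
next
  case False
  then show ?thesis
  proof (cases rule: multiset_Max_cases)
    case 1
    then show ?thesis by (auto simp: pieri_def remove_top_def remove_double_top_def
      lower_double_top_def is_top_def)
  next
    case (2 b K)
    have top_M: "is_top c M \<longleftrightarrow> c = b" for c
      using 2 by (auto simp: is_top_def dest: antisym)
    have dec_b: "dec_part b M = K + (if b = 1 then {#} else {#b - 1#})"
      by (simp add: 2 dec_part_same)
    have UM: "pieri f M = f (dec_part b M) + (\<Sum>x\<in>#K. f (add_mset b (dec_part x K)))"
      for f :: "nat multiset \<Rightarrow> 'a"
    proof -
      have "image_mset (\<lambda>x. f (dec_part x (add_mset b K))) K
          = image_mset (\<lambda>x. f (add_mset b (dec_part x K))) K"
        by (intro image_mset_cong) (simp add: dec_part_add)
      then show ?thesis by (simp add: pieri_def 2(2))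
    qed
    \<comment> \<open>The copy of b that was split off stays in place, so lowering another part
      keeps the top.\<close>
    have top_dec: "is_top c (add_mset b (dec_part x K)) \<longleftrightarrow> c = b" if "x \<in># K" for c x
    proof -
      have "0 \<notin># dec_part x K" "\<forall>y\<in>#dec_part x K. y \<le> b"
        using that 2 by (auto simp: dec_part_def dest!: in_diffD split: if_splits)
           (metis bot_nat_0.extremum_uniqueI le_Suc_eq | force)+
      then show ?thesis using 2(1) by (auto simp: is_top_def dest: antisym)
    qed
    have UR: "pieri (remove_top a h) M = remove_top a h (dec_part b M) +
      (if a = b then pieri h K else 0)"
    proof -
      have "image_mset (\<lambda>x. remove_top a h (add_mset b (dec_part x K))) K
          = image_mset (\<lambda>x. if a = b then h (dec_part x K) else 0) K"
        by (intro image_mset_cong) (simp add: remove_top_def top_dec)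
      then show ?thesis unfolding UM[of "remove_top a h"] by (simp add: pieri_def)
    qed
    have RU: "remove_top a (pieri h) M = (if a = b then pieri h K else 0)"
    proof -
      have "M - {#b#} = K" by (simp add: 2(2))
      then show ?thesis by (simp add: remove_top_def top_M)
    qed
    have key: "remove_top a h (dec_part b M) = remove_top (Suc a) h M + lower_double_top a h M -
      remove_double_top (Suc a) h M"
    proof -
      consider "a = b" | "b = Suc a" | "a \<noteq> b" "b \<noteq> Suc a" by blast
      then show ?thesis
      proof cases
        case 1
        have "is_top b (dec_part b M) \<longleftrightarrow> b \<in># K"
          unfolding dec_b using 2 by (auto simp: is_top_def split: if_splits)
        moreover have "is_top b K \<longleftrightarrow> b \<in># K"
          using 2 by (auto simp: is_top_def)
        moreover have "dec_part b M - {#b#} = dec_part b K" if "b \<in># K"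
        proof -
          obtain K' where "K = add_mset b K'"
            using \<open>b \<in># K\<close> by (blast dest: multi_member_split)
          then show ?thesis unfolding dec_b by (simp add: dec_part_def)
        qed
        ultimately show ?thesis using 1 2(1,2) top_M
          by (simp add: remove_top_def remove_double_top_def lower_double_top_def)
      next
        case b: 2
        have "is_top a (dec_part b M) \<longleftrightarrow> b \<notin># K"
          unfolding dec_b using 2 b by (auto simp: is_top_def le_Suc_eq split: if_splits)
        moreover have "is_top b K \<longleftrightarrow> b \<in># K"
          using 2 by (auto simp: is_top_def)
        moreover have "dec_part b M - {#a#} = K" if "b \<notin># K"
        \<comment> \<open>For a = 0 there is no part to subtract: b = 1 vanishes on lowering, and K
          is empty.\<close>
        proof (cases "a = 0")
          case True
          then have "K = {#}" using 2 b that
            by (metis One_nat_def le_Suc_eq le_zero_eq multiset_nonemptyE)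
          then show ?thesis unfolding dec_b using True b by simp
        qed (unfold dec_b, simp add: b)
        ultimately show ?thesis using b 2(1,2) top_M
          by (simp add: remove_top_def remove_double_top_def lower_double_top_def)
      next
        case 3
        \<comment> \<open>After lowering one copy of b the top is b or b - 1, and a is
          neither.\<close>
        have "\<not> is_top a (dec_part b M)"
        proof
          assume t: "is_top a (dec_part b M)"
          have "b - 1 \<le> a" using t unfolding dec_b by (auto simp: is_top_def split: if_splits)
          moreover have "a \<le> b" using t 2(1,3,4) unfolding dec_b
            by (fastforce simp: is_top_def split: if_splits)
          ultimately show False using 3 by auto
        qed
        then show ?thesis using 3 top_M by (simp add: remove_top_def remove_double_top_def
          lower_double_top_def)
      qed
    qed
    show ?thesis by (simp add: UR RU key)
  qed
qed

lemma pieri_lincomb: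
  "pieri (\<lambda>M. \<Sum>i\<in>I. c i * f i M) = (\<lambda>M. \<Sum>i\<in>I. c i * pieri (f i) M)"
proof
  fix M
  have "(\<Sum>x\<in>#K. \<Sum>i\<in>I. c i * f i (dec_part x M)) =
      (\<Sum>i\<in>I. c i * (\<Sum>x\<in>#K. f i (dec_part x M)))" for K
    by (induction K) (auto simp: sum.distrib algebra_simps)
  then show "pieri (\<lambda>M. \<Sum>i\<in>I. c i * f i M) M = (\<Sum>i\<in>I. c i * pieri (f i) M)"
    by (simp add: pieri_def)
qed

lemma pieri_pow_lincomb:
  "(pieri ^^ k) (\<lambda>M. \<Sum>i\<in>I. c i * f i M) = (\<lambda>M. \<Sum>i\<in>I. c i * (pieri ^^ k) (f i) M)"
  by (induction k) (simp_all add: pieri_lincomb)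

lemma pieri_sum: "pieri (\<lambda>M. \<Sum>i\<in>I. f i M) = (\<lambda>M. \<Sum>i\<in>I. pieri (f i) M)"
  using pieri_lincomb[where I = I and c = "\<lambda>_. 1" and f = f] by simp

lemma pieri_diff: "pieri (\<lambda>M. f M - g M) = (\<lambda>M. pieri f M - pieri g M)"
proof
  fix M
  have "(\<Sum>x\<in>#K. f (dec_part x M) - g (dec_part x M)) =
      (\<Sum>x\<in>#K. f (dec_part x M)) - (\<Sum>x\<in>#K. g (dec_part x M))" for K
    by (induction K) auto
  then show "pieri (\<lambda>M. f M - g M) M = pieri f M - pieri g M"
    by (simp add: pieri_def)
qed

section \<open>Iterated commutators with multiplication by e_1\<close>

definition ad :: "((nat multiset \<Rightarrow> 'a::comm_ring_1) \<Rightarrow> nat multiset \<Rightarrow> 'a) \<Rightarrow>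
    (nat multiset \<Rightarrow> 'a) \<Rightarrow> nat multiset \<Rightarrow> 'a" where
  "ad X h M = pieri (X h) M - X (pieri h) M"

lemma ad_sum: "ad (\<lambda>h M. \<Sum>i\<in>I. X i h M) = (\<lambda>h M. \<Sum>i\<in>I. ad (X i) h M)"
  by (simp add: ad_def fun_eq_iff pieri_sum sum_subtractf)

lemma ad_diff: "ad (\<lambda>h M. X h M - Y h M) = (\<lambda>h M. ad X h M - ad Y h M)"
  by (simp add: ad_def fun_eq_iff pieri_diff)

lemma remove_top_0: "remove_top 0 = remove_double_top 0"
  by (auto simp: remove_top_def remove_double_top_def fun_eq_iff)

lemma remove_top_Suc: "remove_top (Suc a) h M = ad (remove_top a) h M - lower_double_top a h M +
  remove_double_top (Suc a) h M"
  using commutator_pieri_remove_top[of a h M] by (simp add: ad_def algebra_simps)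

text \<open>Unroll the recursion \<open>remove_top_Suc\<close> down to \<open>remove_top_0\<close>.
  The step from r to r + 1 adds \<open>remove_double_top (Suc r)\<close> and subtracts
  \<open>lower_double_top r\<close>; every later step applies \<open>ad\<close> once to what is
  already there.\<close>

lemma remove_top_expand_ad:
  "(remove_top a :: (nat multiset \<Rightarrow> 'a::comm_ring_1) \<Rightarrow> nat multiset \<Rightarrow> 'a) =
    (\<lambda>h M. (\<Sum>r\<le>a. (ad ^^ (a - r)) (remove_double_top r) h M) -
      (\<Sum>r<a. (ad ^^ (a - Suc r)) (lower_double_top r) h M))"
proof (induction a)
  case 0
  then show ?case by (simp add: remove_top_0)
next
  case (Suc a)
  have "(\<Sum>r\<le>a. (ad ^^ (Suc a - r)) (remove_double_top r) h M) =
    (\<Sum>r\<le>a. ad ((ad ^^ (a - r)) (remove_double_top r)) h M)" for h :: "nat multiset \<Rightarrow> 'a" and M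
    by (rule sum.cong) (simp_all add: Suc_diff_le)
  moreover have "(\<Sum>r<a. (ad ^^ (Suc a - Suc r)) (lower_double_top r) h M) =
    (\<Sum>r<a. ad ((ad ^^ (a - Suc r)) (lower_double_top r)) h M)" for h :: "nat multiset \<Rightarrow> 'a" and M
  proof (rule sum.cong)
    fix r assume "r \<in> {..<a}"
    then have "Suc a - Suc r = Suc (a - Suc r)" by auto
    then show "(ad ^^ (Suc a - Suc r)) (lower_double_top r) h M =
      ad ((ad ^^ (a - Suc r)) (lower_double_top r)) h M" by simp
  qed simp
  moreover have "ad (remove_top a :: (nat multiset \<Rightarrow> 'a) \<Rightarrow> nat multiset \<Rightarrow> 'a) =
    (\<lambda>h M. (\<Sum>r\<le>a. ad ((ad ^^ (a - r)) (remove_double_top r)) h M) -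
      (\<Sum>r<a. ad ((ad ^^ (a - Suc r)) (lower_double_top r)) h M))"
    by (simp add: Suc.IH ad_diff ad_sum)
  ultimately show ?case
    by (simp add: remove_top_Suc fun_eq_iff)
qed

text \<open>\<open>ad\<close> is the difference of composing with \<open>pieri\<close> on the left
  and on the right. These two operations commute, so this is the binomial theorem.\<close>

lemma ad_pow_expand:
  "(ad ^^ k) X h M = (\<Sum>j\<le>k. (-1) ^ j * of_nat (k choose j) * (pieri ^^ (k - j))
    (X ((pieri ^^ j) h)) M)"
proof (induction k arbitrary: h M)
  case 0
  then show ?case by simp
next
  case (Suc k)
  define t where "t j = (pieri ^^ (Suc k - j)) (X ((pieri ^^ j) h)) M" for j
  have IH: "(ad ^^ k) X g = (\<lambda>M. \<Sum>j\<le>k. (-1) ^ j * of_nat (k choose j) * (pieri ^^ (k - j))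
    (X ((pieri ^^ j) g)) M)" for g
    using Suc.IH by blast
  have 1: "pieri ((ad ^^ k) X h) M = (\<Sum>j\<le>k. (-1) ^ j * of_nat (k choose j) * t j)"
    unfolding IH[of h] pieri_lincomb t_def by (intro sum.cong) (simp_all add: Suc_diff_le)
  have 2: "(ad ^^ k) X (pieri h) M = (\<Sum>j\<le>k. (-1) ^ j * of_nat (k choose j) * t (Suc j))"
    unfolding Suc.IH[of "pieri h"] t_def by (simp add: funpow_swap1)
  \<comment> \<open>Pascal's rule splits the sum for k + 1 into the sums of \<open>1\<close> and
    \<open>2\<close>.\<close>
  have "(\<Sum>j\<le>Suc k. (-1) ^ j * of_nat (Suc k choose j) * t j) =
      t 0 + (\<Sum>j\<le>k. (-1) ^ Suc j * of_nat (Suc k choose Suc j) * t (Suc j))"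
    by (simp only: sum.atMost_Suc_shift) simp
  also have "\<dots> = (t 0 + (\<Sum>j\<le>k. (-1) ^ Suc j * of_nat (k choose Suc j) * t (Suc j))) -
      (\<Sum>j\<le>k. (-1) ^ j * of_nat (k choose j) * t (Suc j))"
  proof -
    have "(-1) ^ Suc j * of_nat (Suc k choose Suc j) * t (Suc j) =
        (-1) ^ Suc j * of_nat (k choose Suc j) * t (Suc j) -
        (-1) ^ j * of_nat (k choose j) * t (Suc j)" for j
      by (simp add: algebra_simps)
    then show ?thesis by (simp only: sum_subtractf) simp
  qed
  also have "t 0 + (\<Sum>j\<le>k. (-1) ^ Suc j * of_nat (k choose Suc j) * t (Suc j)) =
      (\<Sum>j\<le>Suc k. (-1) ^ j * of_nat (k choose j) * t j)"
    by (simp only: sum.atMost_Suc_shift) simp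
  also have "\<dots> = (\<Sum>j\<le>k. (-1) ^ j * of_nat (k choose j) * t j)"
    by (simp add: binomial_eq_0)
  finally show ?case
    unfolding funpow.simps comp_def using 1 2 by (simp add: ad_def[of "(ad ^^ k) X"] t_def)
qed

section \<open>Degrees of coefficient functions\<close>

definition homog :: "nat \<Rightarrow> (nat multiset \<Rightarrow> 'a::comm_ring_1) \<Rightarrow> bool" where
  "homog d f \<longleftrightarrow> (\<forall>M. f M \<noteq> 0 \<longrightarrow> 0 \<notin># M \<and> sum_mset M = d)"

lemma homogD: "homog d f \<Longrightarrow> f M \<noteq> 0 \<Longrightarrow> 0 \<notin># M \<and> sum_mset M = d"
  by (simp add: homog_def)

lemma sum_dec_part: "x \<in># M \<Longrightarrow> x > 0 \<Longrightarrow> Suc (\<Sum>\<^sub># (dec_part x M)) = \<Sum>\<^sub># M"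
  by (auto simp: dec_part_def dest!: multi_member_split)

lemma homog_pieri:
  assumes "homog d f"
  shows "homog (Suc d) (pieri f)"
  unfolding homog_def
proof (intro allI impI)
  fix M assume "pieri f M \<noteq> 0"
  then obtain x where x: "x \<in># M" "f (dec_part x M) \<noteq> 0"
    unfolding pieri_def by (metis (mono_tags, lifting) image_mset_cong image_mset_const_eq
        sum_mset_replicate_mset mult_zero_right)
  then have "0 \<notin># M" "\<Sum>\<^sub># (dec_part x M) = d"
    using homogD[OF assms] zero_mem_dec_part by blast+
  with x show "0 \<notin># M \<and> \<Sum>\<^sub># M = Suc d"
    using sum_dec_part[of x M] by (metis gr0I)
qed

lemma homog_pieri_pow: "homog d f \<Longrightarrow> homog (d + j) ((pieri ^^ j) f)"
  by (induction j) (auto simp: homog_pieri)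

text \<open>The coefficient function of the monomial symmetric function with index K.\<close>

definition \<delta> :: "nat multiset \<Rightarrow> nat multiset \<Rightarrow> 'a::comm_ring_1" where
  "\<delta> K M = of_bool (M = K)"

lemma homog_\<delta>: "0 \<notin># K \<Longrightarrow> homog (\<Sum>\<^sub># K) (\<delta> K)"
  by (simp add: homog_def \<delta>_def)

subsection \<open>Expansion over partitions\<close>

lemma partitionsD:
  assumes "\<kappa> \<in> partitions n"
  shows "sorted_wrt (\<ge>) \<kappa>" "0 \<notin> set \<kappa>" "sum_list \<kappa> = n"
  using assms by (auto simp: partitions_def)

lemma length_partition:
  assumes "xs \<in> partitions n"
  shows "length xs \<le> n"
proof -
  have *: "0 \<notin> set xs" "sum_list xs = n" using partitionsD[OF assms] by auto
  have "length xs = (\<Sum>x\<leftarrow>xs. 1)" by (simp add: sum_list_triv)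
  also have "\<dots> \<le> (\<Sum>x\<leftarrow>xs. x)"
    by (rule sum_list_mono) (use *(1) in \<open>metis One_nat_def Suc_leI gr0I\<close>)
  finally show ?thesis using * by simp
qed

lemma finite_partitions: "finite (partitions n)"
proof (rule finite_subset)
  show "partitions n \<subseteq> {xs. set xs \<subseteq> {..n} \<and> length xs \<le> n}"
  proof
    fix xs assume "xs \<in> partitions n"
    then show "xs \<in> {xs. set xs \<subseteq> {..n} \<and> length xs \<le> n}"
      using length_partition[of xs n] member_le_sum_list[of _ xs] partitionsD(3)[of xs n] by auto
  qed
qed (simp add: finite_lists_length_le)

lemma partitions_mset_inj:
  assumes "\<kappa> \<in> partitions n" "\<kappa>' \<in> partitions m" "mset \<kappa> = mset \<kappa>'"
  shows "\<kappa> = \<kappa>'"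
proof -
  have "sorted (rev \<kappa>)" "sorted (rev \<kappa>')"
    using assms by (auto simp: partitions_def sorted_wrt_rev)
  then have "rev \<kappa> = rev \<kappa>'"
    using assms(3) by (metis mset_rev properties_for_sort)
  then show ?thesis by simp
qed

lemma partition_of_mset:
  assumes "0 \<notin># M"
  obtains \<kappa> where "\<kappa> \<in> partitions (\<Sum>\<^sub># M)" "mset \<kappa> = M"
proof
  let ?k = "rev (sorted_list_of_multiset M)"
  show *: "mset ?k = M" by simp
  have "sum_list ?k = \<Sum>\<^sub># M" by (metis * sum_mset_sum_list)
  moreover have "0 \<notin> set ?k" using assms by simp
  ultimately show "?k \<in> partitions (\<Sum>\<^sub># M)"
    by (simp add: partitions_def sorted_wrt_rev)
qed

lemma tl_partition:
  "\<kappa> \<in> partitions n \<Longrightarrow> tl \<kappa> \<in> partitions (n - part \<kappa> 1)"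
  by (cases \<kappa>) (auto simp: partitions_def Defs.part_def)

lemma partition_nonempty: "\<kappa> \<in> partitions n \<Longrightarrow> n \<ge> 1 \<Longrightarrow> \<kappa> \<noteq> []"
  by (auto simp: partitions_def)

lemma part_le: "\<kappa> \<in> partitions n \<Longrightarrow> part \<kappa> 1 \<le> n"
  by (cases \<kappa>) (auto simp: partitions_def Defs.part_def)

lemma part_2_le: "\<kappa> \<in> partitions n \<Longrightarrow> part \<kappa> 2 \<le> part \<kappa> 1"
  by (cases \<kappa>; cases "tl \<kappa>") (auto simp: partitions_def Defs.part_def)

lemma part_1: "\<kappa> \<noteq> [] \<Longrightarrow> part \<kappa> 1 = hd \<kappa>"
  by (cases \<kappa>) (auto simp: Defs.part_def)

lemma part_2_tl: "part \<kappa> 2 = (if tl \<kappa> = [] then 0 else hd (tl \<kappa>))"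
  by (cases \<kappa>; cases "tl \<kappa>") (auto simp: Defs.part_def)

section \<open>Partitions as indices of the functions \<open>mtilde\<close>\<close>

definition mtilde_index :: "nat list \<Rightarrow> nat multiset" where
  "mtilde_index \<kappa> = (if tl \<kappa> = [] then {#} else add_mset (part \<kappa> 2) (mset (tl \<kappa>)))"

abbreviation mtilde_coeff :: "nat list \<Rightarrow> nat multiset \<Rightarrow> 'a::comm_ring_1" where
  "mtilde_coeff \<kappa> \<equiv> (pieri ^^ (part \<kappa> 1 - part \<kappa> 2)) (\<delta> (mtilde_index \<kappa>))"

lemma mtilde_index_props:
  assumes "\<kappa> \<in> partitions n"
  shows "is_top (part \<kappa> 2) (mtilde_index \<kappa>)" "mtilde_index \<kappa> - {#part \<kappa> 2#} = mset (tl \<kappa>)"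
    "is_top (part \<kappa> 2) (mset (tl \<kappa>))"
  using partitionsD[OF assms]
  by (cases \<kappa>; cases "tl \<kappa>"; auto simp: mtilde_index_def part_2_tl is_top_def)+

text \<open>A multiset M in the support of G has its top r repeated, or is empty with r = 0. Trading
  one copy of r for a part that is at least r gives a partition whose \<open>mtilde_index\<close> is
  M. The size n forces this part to be n - e, and e + r \<le> n makes it large enough.\<close>

lemma expand_in_mtilde_index:
  fixes G :: "nat multiset \<Rightarrow> 'a::comm_ring_1"
  assumes G: "\<And>M. G M \<noteq> 0 \<Longrightarrow> is_top r M \<and> is_top r (M - {#r#}) \<and> \<Sum>\<^sub># (M - {#r#}) = e"
    and "e + r \<le> n" "n \<ge> 1"
  shows "G M = (\<Sum>\<kappa>\<in>partitions n. (if part \<kappa> 2 = r \<and> part \<kappa> 1 = n - e then G (mtilde_index \<kappa>)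
    else 0) * \<delta> (mtilde_index \<kappa>) M)"
proof (cases "\<exists>\<kappa>\<in>partitions n. part \<kappa> 2 = r \<and> part \<kappa> 1 = n - e \<and> mtilde_index \<kappa> = M")
  case True
  then obtain \<kappa> where \<kappa>: "\<kappa> \<in> partitions n" "part \<kappa> 2 = r" "part \<kappa> 1 = n - e" "mtilde_index \<kappa> = M"
    by blast
  have unique: "\<kappa>' = \<kappa>" if "\<kappa>' \<in> partitions n" "part \<kappa>' 2 = r" "part \<kappa>' 1 = n - e"
    "mtilde_index \<kappa>' = M" for \<kappa>'
  proof -
    have "mset (tl \<kappa>') = mset (tl \<kappa>)"
      using mtilde_index_props(2) that \<kappa> by metis
    then have "tl \<kappa>' = tl \<kappa>"
      using partitions_mset_inj tl_partition that(1) \<kappa>(1) by metis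
    moreover have ne: "\<kappa> \<noteq> []" "\<kappa>' \<noteq> []"
      using partition_nonempty that(1) \<kappa>(1) assms(3) by blast+
    moreover have "hd \<kappa>' = hd \<kappa>"
      using that(3) \<kappa>(3) by (simp only: part_1 ne not_False_eq_True simp_thms)
    ultimately show ?thesis by (simp add: list.expand)
  qed
  have "(\<Sum>\<kappa>'\<in>partitions n. (if part \<kappa>' 2 = r \<and> part \<kappa>' 1 = n - e then G (mtilde_index \<kappa>') else 0)
    * \<delta> (mtilde_index \<kappa>') M)
      = (\<Sum>\<kappa>'\<in>partitions n. if \<kappa>' = \<kappa> then G M else 0)"
  proof (intro sum.cong refl)
    fix \<kappa>' assume \<kappa>': "\<kappa>' \<in> partitions n"
    show "(if part \<kappa>' 2 = r \<and> part \<kappa>' 1 = n - e then G (mtilde_index \<kappa>') else 0) * \<delta>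
      (mtilde_index \<kappa>') M =
        (if \<kappa>' = \<kappa> then G M else 0)"
    proof (cases "\<kappa>' = \<kappa>")
      case True
      then show ?thesis using \<kappa>(2-) by (simp add: \<delta>_def)
    next
      case False
      then have "\<not> (part \<kappa>' 2 = r \<and> part \<kappa>' 1 = n - e \<and> mtilde_index \<kappa>' = M)"
        using unique \<kappa>' by blast
      then show ?thesis using False by (auto simp: \<delta>_def)
    qed
  qed
  then show ?thesis using \<kappa> by (simp add: finite_partitions)
next
  case False
  then have "(\<Sum>\<kappa>'\<in>partitions n. (if part \<kappa>' 2 = r \<and> part \<kappa>' 1 = n - e then G (mtilde_index \<kappa>')
    else 0) * \<delta> (mtilde_index \<kappa>') M) = 0"
    by (intro sum.neutral) (auto simp: \<delta>_def)
  moreover have "G M = 0"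
  proof (rule ccontr)
    assume "G M \<noteq> 0"
    then have t: "is_top r M" "is_top r (M - {#r#})" "\<Sum>\<^sub># (M - {#r#}) = e"
      using G by blast+
    then obtain ks where ks: "ks \<in> partitions e" "mset ks = M - {#r#}"
      using partition_of_mset[of "M - {#r#}"] by (auto simp: is_top_def)
    have le: "\<forall>x\<in>set ks. x \<le> r" using t(2) ks(2) by (metis is_top_def set_mset_mset)
    define \<kappa> where "\<kappa> = (n - e) # ks"
    \<comment> \<open>If r = 0 then M is empty, so e = 0 and the claim is n \<ge> 1.\<close>
    have pos: "n - e > 0" using t assms(2,3) by (cases "r = 0") auto
    have \<kappa>: "\<kappa> \<in> partitions n"
      using ks(1) le pos assms(2) by (auto simp: \<kappa>_def partitions_def intro: order_trans)
    have "part \<kappa> 1 = n - e" by (simp add: \<kappa>_def Defs.part_def)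
    moreover have 2: "part \<kappa> 2 = r"
    proof (cases ks)
      case Nil
      then show ?thesis using t ks by (auto simp: \<kappa>_def Defs.part_def is_top_def)
    next
      case (Cons x xs)
      have "r \<noteq> 0" using Cons t(1) ks(2) by (cases r) auto
      then have "r \<in> set ks" using t(2) ks(2) by (metis is_top_def set_mset_mset)
      moreover have "\<forall>y\<in>set ks. y \<le> x" using ks(1) Cons by (auto simp: partitions_def)
      moreover have "x \<le> r" using le Cons by simp
      ultimately have "x = r" by auto
      then show ?thesis using Cons by (simp add: \<kappa>_def Defs.part_def)
    qed
    moreover have "mtilde_index \<kappa> = M"
    proof (cases ks)
      case Nil
      then have "r = 0" using t ks by (auto simp: is_top_def)
      then show ?thesis using t Nil by (simp add: mtilde_index_def \<kappa>_def)
    next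
      case (Cons x xs)
      have "r \<noteq> 0" using Cons t(1) ks(2) by (cases r) auto
      then have "r \<in># M" using t by (simp add: is_top_def)
      then show ?thesis using Cons ks 2 by (simp add: mtilde_index_def \<kappa>_def)
    qed
    ultimately show False using False \<kappa> by blast
  qed
  ultimately show ?thesis by simp
qed

text \<open>The condition selects r = k2 and j = a - k1; k2 \<le> k1 places this j in the inner
  range.\<close>

lemma double_sum_delta:
  fixes k1 k2 a :: nat
  assumes "k2 \<le> k1"
  shows "(\<Sum>r\<le>a. \<Sum>j\<le>a - r. if k2 = r \<and> k1 = a - j then c r j else 0) =
    (if k1 \<le> a then c k2 (a - k1) else (0::'a::comm_ring_1))"
proof -
  have "(\<Sum>j\<le>a - r. if k2 = r \<and> k1 = a - j then c r j else 0) =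
      (if k2 = r then if k1 \<le> a then c k2 (a - k1) else 0 else 0)" if "r \<le> a" for r
  proof (cases "k2 = r \<and> k1 \<le> a")
    case True
    then have "(\<Sum>j\<le>a - r. if k2 = r \<and> k1 = a - j then c r j else 0) =
        (\<Sum>j\<le>a - r. if j = a - k1 then c k2 (a - k1) else 0)"
      using that by (intro sum.cong) auto
    then show ?thesis using True assms by auto
  qed (use that in \<open>auto intro!: sum.neutral\<close>)
  then have "(\<Sum>r\<le>a. \<Sum>j\<le>a - r. if k2 = r \<and> k1 = a - j then c r j else 0) =
      (\<Sum>r\<le>a. if k2 = r then if k1 \<le> a then c k2 (a - k1) else 0 else 0)"
    by (intro sum.cong) auto
  then show ?thesis using assms by auto
qed

text \<open>A partition \<open>\<kappa>\<close> of \<open>n\<close> arises from exactly one pair \<open>(r, j)\<close>, namely \<open>r = \<kappa>\<^sub>2\<close> and \<open>j = b - \<kappa>\<^sub>1\<close>,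
  because the degree of \<open>U\<^sup>j h\<close> determines the size of \<open>(\<kappa>\<^sub>2, \<kappa>\<^sub>3, \<dots>)\<close>.\<close>

lemma sum_ad_expand:
  fixes X :: "nat \<Rightarrow> (nat multiset \<Rightarrow> 'a::comm_ring_1) \<Rightarrow> nat multiset \<Rightarrow> 'a"
  assumes X: "\<And>r j M. r + j \<le> b \<Longrightarrow> X r ((pieri ^^ j) h) M \<noteq> 0 \<Longrightarrow>
      is_top r M \<and> is_top r (M - {#r#}) \<and> \<Sum>\<^sub># (M - {#r#}) + b = n + j"
    and "b \<le> n" "n \<ge> 1"
  shows "(\<Sum>r\<le>b. (ad ^^ (b - r)) (X r) h M) =
    (\<Sum>\<kappa>\<in>partitions n. (if part \<kappa> 1 \<le> b then (-1) ^ (b - part \<kappa> 1) *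
       of_nat ((b - part \<kappa> 2) choose (b - part \<kappa> 1)) * X (part \<kappa> 2) ((pieri ^^ (b - part \<kappa> 1)) h)
         (mtilde_index \<kappa>) else 0) *
       mtilde_coeff \<kappa> M)"
proof -
  define c where "c \<kappa> r j = (-1) ^ j * of_nat ((b - r) choose j) * X r ((pieri ^^ j) h)
    (mtilde_index \<kappa>) *
      (pieri ^^ (b - j - r)) (\<delta> (mtilde_index \<kappa>)) M" for \<kappa> r j
  have "(\<Sum>r\<le>b. (ad ^^ (b - r)) (X r) h M) =
     (\<Sum>r\<le>b. \<Sum>j\<le>b - r. \<Sum>\<kappa>\<in>partitions n. if part \<kappa> 2 = r \<and> part \<kappa> 1 = b - j then c \<kappa> r j else 0)"
  proof (intro sum.cong refl)
    fix r assume r: "r \<in> {..b}"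
    have *: "(pieri ^^ k) (X r ((pieri ^^ j) h)) M = (\<Sum>\<kappa>\<in>partitions n.
        (if part \<kappa> 2 = r \<and> part \<kappa> 1 = b - j then X r ((pieri ^^ j) h) (mtilde_index \<kappa>) else 0) *
          (pieri ^^ k) (\<delta> (mtilde_index \<kappa>)) M)"
      if "j \<le> b - r" for j k
    proof -
      \<comment> \<open>Here e = n + j - b, so the first part n - e of the matching partitions is b
        - j.\<close>
      have "n - (n + j - b) = b - j" using that assms(2) by auto
      then have "X r ((pieri ^^ j) h) = (\<lambda>M. (\<Sum>\<kappa>\<in>partitions n.
        (if part \<kappa> 2 = r \<and> part \<kappa> 1 = b - j then X r ((pieri ^^ j) h) (mtilde_index \<kappa>) else 0) * \<delta>
          (mtilde_index \<kappa>) M))"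
        using expand_in_mtilde_index[of "X r ((pieri ^^ j) h)" r "n + j - b" n] X[of r j]
          assms(2,3) that r
        by fastforce
      from arg_cong[OF this, of "\<lambda>f. (pieri ^^ k) f M"]
      show ?thesis unfolding pieri_pow_lincomb using that assms(2) by simp
    qed
    show "(ad ^^ (b - r)) (X r) h M =
     (\<Sum>j\<le>b - r. \<Sum>\<kappa>\<in>partitions n. if part \<kappa> 2 = r \<and> part \<kappa> 1 = b - j then c \<kappa> r j else 0)"
      unfolding ad_pow_expand
    proof (intro sum.cong refl)
      fix j assume "j \<in> {..b - r}"
      then have "j \<le> b - r" by simp
      \<comment> \<open>With r = \<kappa>_2 and b - j = \<kappa>_1 this exponent is \<kappa>_1 -
        \<kappa>_2, the power of e_1 in \<open>mtilde\<close>.\<close>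
      moreover have "b - r - j = b - j - r" by simp
      ultimately show "(-1) ^ j * of_nat ((b - r) choose j) * (pieri ^^ (b - r - j))
        (X r ((pieri ^^ j) h)) M =
        (\<Sum>\<kappa>\<in>partitions n. if part \<kappa> 2 = r \<and> part \<kappa> 1 = b - j then c \<kappa> r j else 0)"
        by (subst *) (auto simp: sum_distrib_left c_def mult_ac intro!: sum.cong)
    qed
  qed
  also have "\<dots> = (\<Sum>\<kappa>\<in>partitions n. \<Sum>r\<le>b. \<Sum>j\<le>b - r. if part \<kappa> 2 = r \<and> part \<kappa> 1 = b - j then c \<kappa>
    r j else 0)"
    by (subst sum.swap[where B = "partitions n"], subst sum.swap[where B = "partitions n"])
      (rule refl)
  also have "\<dots> = (\<Sum>\<kappa>\<in>partitions n. if part \<kappa> 1 \<le> b then c \<kappa> (part \<kappa> 2) (b - part \<kappa> 1) else 0)"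
    by (intro sum.cong refl double_sum_delta part_2_le)
  also have "\<dots> = (\<Sum>\<kappa>\<in>partitions n. (if part \<kappa> 1 \<le> b then (-1) ^ (b - part \<kappa> 1) *
       of_nat ((b - part \<kappa> 2) choose (b - part \<kappa> 1)) * X (part \<kappa> 2) ((pieri ^^ (b - part \<kappa> 1)) h)
         (mtilde_index \<kappa>) else 0) *
       mtilde_coeff \<kappa> M)"
    by (intro sum.cong) (auto simp: c_def)
  finally show ?thesis .
qed

text \<open>The matrix entry as the operator identity delivers it: the first summand comes from the
  \<open>remove_double_top\<close> terms, with b = a in \<open>sum_ad_expand\<close>, the second
  from the \<open>lower_double_top\<close> terms, with b = a - 1.\<close>

definition trans_coeff :: "nat list \<Rightarrow> nat list \<Rightarrow> 'a::comm_ring_1" where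
  "trans_coeff lam \<kappa> = (let a = part lam 1; k1 = part \<kappa> 1; k2 = part \<kappa> 2 in
     (if k1 \<le> a then (-1) ^ (a - k1) * of_nat ((a - k2) choose (a - k1)) *
        (pieri ^^ (a - k1)) (\<delta> (mset (tl lam))) (mset (tl \<kappa>)) else 0) -
     (if k1 < a \<and> k2 > 0 then (-1) ^ (a - 1 - k1) * of_nat ((a - 1 - k2) choose (a - 1 - k1)) *
        (pieri ^^ (a - 1 - k1)) (\<delta> (mset (tl lam))) (dec_part k2 (mset (tl \<kappa>))) else 0))"

text \<open>Adjoining the top part a = \<lambda>_1 to the index of h gives back \<lambda>, so the
  left side is \<open>remove_top a h\<close>. Both sums of \<open>remove_top_expand_ad\<close> are
  then instances of \<open>sum_ad_expand\<close>.\<close>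

lemma delta_expand:
  assumes lam: "lam \<in> partitions n" and n: "n \<ge> 1"
  shows "\<delta> (mset lam) M = (\<Sum>\<kappa>\<in>partitions n. trans_coeff lam \<kappa> *
     mtilde_coeff \<kappa> M :: 'a::comm_ring_1)"
proof -
  define a where "a = part lam 1"
  define h :: "nat multiset \<Rightarrow> 'a" where "h = \<delta> (mset (tl lam))"
  obtain l where l: "lam = a # l"
    using partition_nonempty[OF lam n] by (cases lam) (auto simp: a_def Defs.part_def)
  have a: "a \<le> n" "a > 0" and lp: "0 \<notin> set l" "\<forall>x\<in>set l. x \<le> a" "sum_list l = n - a"
    using partitionsD[OF lam] by (auto simp: l)
  have remove_top: "remove_top a h M = \<delta> (mset lam) M"
    using a lp by (auto simp: remove_top_def h_def \<delta>_def l is_top_def) (metis insert_DiffM)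
  have "homog (n - a) h"
    using homog_\<delta>[of "mset l"] lp by (simp add: h_def l sum_mset_sum_list)
  then have hom: "homog (n - a + j) ((pieri ^^ j) h)" for j
    by (rule homog_pieri_pow)
  have 1: "(\<Sum>r\<le>a. (ad ^^ (a - r)) (remove_double_top r) h M) =
    (\<Sum>\<kappa>\<in>partitions n. (if part \<kappa> 1 \<le> a then (-1) ^ (a - part \<kappa> 1) *
       of_nat ((a - part \<kappa> 2) choose (a - part \<kappa> 1)) * remove_double_top (part \<kappa> 2)
         ((pieri ^^ (a - part \<kappa> 1)) h) (mtilde_index \<kappa>) else 0) *
       mtilde_coeff \<kappa> M)"
  proof (rule sum_ad_expand)
    fix r j M assume "remove_double_top r ((pieri ^^ j) h) M \<noteq> 0"
    then show "is_top r M \<and> is_top r (M - {#r#}) \<and> \<Sum>\<^sub># (M - {#r#}) + a = n + j"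
      using homogD[OF hom, of j "M - {#r#}"] a
        by (auto simp: remove_double_top_def split: if_splits)
  qed (use a n in auto)
  have 2: "(\<Sum>r\<le>a-1. (ad ^^ (a - 1 - r)) (lower_double_top r) h M) =
    (\<Sum>\<kappa>\<in>partitions n. (if part \<kappa> 1 \<le> a-1 then (-1) ^ (a - 1 - part \<kappa> 1) *
       of_nat ((a - 1 - part \<kappa> 2) choose (a - 1 - part \<kappa> 1)) * lower_double_top (part \<kappa> 2)
         ((pieri ^^ (a - 1 - part \<kappa> 1)) h) (mtilde_index \<kappa>) else 0) *
       mtilde_coeff \<kappa> M)"
  proof (rule sum_ad_expand)
    fix r j M assume "lower_double_top r ((pieri ^^ j) h) M \<noteq> 0"
    then have *: "r > 0" "is_top r M" "is_top r (M - {#r#})"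
      "(pieri ^^ j) h (dec_part r (M - {#r#})) \<noteq> 0"
      by (auto simp: lower_double_top_def split: if_splits)
    then have "\<Sum>\<^sub># (dec_part r (M - {#r#})) = n - a + j"
      using homogD[OF hom] by blast
    \<comment> \<open>Lowering a part costs one degree; hence a - 1 takes the place of a in this
      sum.\<close>
    then have "\<Sum>\<^sub># (M - {#r#}) = Suc (n - a + j)"
      using sum_dec_part[of r "M - {#r#}"] * by (auto simp: is_top_def)
    then show "is_top r M \<and> is_top r (M - {#r#}) \<and> \<Sum>\<^sub># (M - {#r#}) + (a - 1) = n + j"
      using * a by auto
  qed (use a n in auto)
  have "remove_top a h M = (\<Sum>r\<le>a. (ad ^^ (a - r)) (remove_double_top r) h M) -
    (\<Sum>r\<le>a-1. (ad ^^ (a - 1 - r)) (lower_double_top r) h M)"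
  proof -
    \<comment> \<open>Since a > 0, the strict range has the form required by
      \<open>2\<close>.\<close>
    have "{..<a} = {..a-1}" using a by auto
    then show ?thesis by (simp add: remove_top_expand_ad)
  qed
  also have "\<dots> = (\<Sum>\<kappa>\<in>partitions n. trans_coeff lam \<kappa> * mtilde_coeff \<kappa> M)"
    unfolding 1 2 sum_subtractf[symmetric] left_diff_distrib[symmetric]
  proof (intro sum.cong refl arg_cong2[where f = "(*)"])
    fix \<kappa> assume \<kappa>: "\<kappa> \<in> partitions n"
    have "remove_double_top (part \<kappa> 2) g (mtilde_index \<kappa>) = g (mset (tl \<kappa>))"
      for g :: "nat multiset \<Rightarrow> 'a"
      using mtilde_index_props[OF \<kappa>] by (simp add: remove_double_top_def)
    moreover have "lower_double_top (part \<kappa> 2) g (mtilde_index \<kappa>) =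
      (if part \<kappa> 2 > 0 then g (dec_part (part \<kappa> 2) (mset (tl \<kappa>))) else 0)"
      for g :: "nat multiset \<Rightarrow> 'a"
      using mtilde_index_props[OF \<kappa>] by (simp add: lower_double_top_def)
    moreover have "part \<kappa> 1 \<le> a - 1 \<longleftrightarrow> part \<kappa> 1 < a" using a by auto
    moreover have "lower_double_top 0 g M' = 0" for g :: "nat multiset \<Rightarrow> 'a" and M'
      by (simp add: lower_double_top_def)
    moreover have "part lam (Suc 0) = a" by (simp add: a_def)
    ultimately show "(if part \<kappa> 1 \<le> a then (-1) ^ (a - part \<kappa> 1) *
       of_nat ((a - part \<kappa> 2) choose (a - part \<kappa> 1)) * remove_double_top (part \<kappa> 2)
         ((pieri ^^ (a - part \<kappa> 1)) h) (mtilde_index \<kappa>) else 0) -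
       (if part \<kappa> 1 \<le> a-1 then (-1) ^ (a - 1 - part \<kappa> 1) *
       of_nat ((a - 1 - part \<kappa> 2) choose (a - 1 - part \<kappa> 1)) * lower_double_top (part \<kappa> 2)
         ((pieri ^^ (a - 1 - part \<kappa> 1)) h) (mtilde_index \<kappa>) else 0)
       = trans_coeff lam \<kappa>"
      by (simp add: trans_coeff_def Let_def h_def[symmetric])
  qed
  finally show ?thesis by (simp add: remove_top)
qed

subsection \<open>Coefficient functions of symmetric polynomials\<close>

text \<open>Plays the role of \<alpha>^+, with a multiset in place of a sorted list.\<close>

definition exponent_type :: "(nat \<Rightarrow>\<^sub>0 nat) \<Rightarrow> nat multiset" where
  "exponent_type \<alpha> = image_mset (Poly_Mapping.lookup \<alpha>) (mset_set (Poly_Mapping.keys \<alpha>))"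

text \<open>This makes p symmetric in the first N variables and free of all others. One f serves
  every N; its values at multisets containing 0 or having more than N parts are left open.\<close>

definition represents :: "nat \<Rightarrow> 'a::comm_ring_1 mpoly \<Rightarrow> (nat multiset \<Rightarrow> 'a) \<Rightarrow> bool" where
  "represents N p f \<longleftrightarrow>
     (\<forall>\<alpha>. Poly_Mapping.lookup p \<alpha> = (if Poly_Mapping.keys \<alpha> \<subseteq> {..<N} then f (exponent_type \<alpha>)
       else 0))"

lemma zero_notin_exponent_type: "0 \<notin># exponent_type \<alpha>"
  by (auto simp: exponent_type_def in_keys_iff)

lemma lookup_single_mult_add:
  fixes p :: "'a::comm_ring_1 mpoly"
  shows "Poly_Mapping.lookup (Poly_Mapping.single t c * p) (t + q) = c * Poly_Mapping.lookup p q"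
  by (simp add: lookup_mult lookup_single when_mult)

lemma lookup_single_mult_0:
  fixes p :: "'a::comm_ring_1 mpoly"
  shows "(\<And>q. k \<noteq> t + q) \<Longrightarrow> Poly_Mapping.lookup (Poly_Mapping.single t c * p) k = 0"
  by (simp add: lookup_mult lookup_single when_mult)

lemma lookup_Var_mult:
  "Poly_Mapping.lookup (Var i * p) \<beta> =
    (if i \<in> Poly_Mapping.keys \<beta> then Poly_Mapping.lookup p (\<beta> - Poly_Mapping.single i 1) else 0)"
proof (cases "i \<in> Poly_Mapping.keys \<beta>")
  case True
  then have "\<beta> = Poly_Mapping.single i 1 + (\<beta> - Poly_Mapping.single i 1)"
    by (intro poly_mapping_eqI) (auto simp: lookup_add lookup_minus lookup_single when_def
      in_keys_iff)
  then show ?thesis using True lookup_single_mult_add[of "Poly_Mapping.single i 1" 1 p]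
    unfolding Var_def by (metis mult_1)
next
  case False
  then have "\<beta> \<noteq> Poly_Mapping.single i 1 + q" for q
    by (auto simp: in_keys_iff lookup_add)
  then show ?thesis using False by (simp add: Var_def lookup_single_mult_0)
qed

text \<open>An exponent 1 leaves the set of keys when lowered, which matches the special case in
  \<open>dec_part\<close>.\<close>

lemma exponent_type_dec:
  assumes "i \<in> Poly_Mapping.keys \<beta>"
  shows "exponent_type (\<beta> - Poly_Mapping.single i 1) = dec_part (Poly_Mapping.lookup \<beta> i)
    (exponent_type \<beta>)"
proof -
  let ?\<gamma> = "\<beta> - Poly_Mapping.single i (1::nat)" and ?K = "Poly_Mapping.keys \<beta> - {i}"
  have \<gamma>: "Poly_Mapping.lookup ?\<gamma> j = (if j = i then Poly_Mapping.lookup \<beta> i -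
    1 else Poly_Mapping.lookup \<beta> j)" for j
    by (simp add: lookup_minus lookup_single when_def)
  have K: "mset_set (Poly_Mapping.keys \<beta>) = add_mset i (mset_set ?K)"
    using assms by (metis finite_keys mset_set.remove)
  have b: "exponent_type \<beta> = add_mset (Poly_Mapping.lookup \<beta> i)
    (image_mset (Poly_Mapping.lookup \<beta>) (mset_set ?K))"
    by (simp add: exponent_type_def K)
  have img: "image_mset (Poly_Mapping.lookup ?\<gamma>) (mset_set ?K) =
    image_mset (Poly_Mapping.lookup \<beta>) (mset_set ?K)"
    by (intro image_mset_cong) (auto simp: \<gamma> simp del: One_nat_def)
  show ?thesis
  proof (cases "Poly_Mapping.lookup \<beta> i = 1")
    case True
    then have "Poly_Mapping.keys ?\<gamma> = ?K" using \<gamma> by (auto simp: in_keys_iff split: if_splits)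
    then have "exponent_type ?\<gamma> = image_mset (Poly_Mapping.lookup \<beta>) (mset_set ?K)"
      using img by (simp only: exponent_type_def)
    then show ?thesis using True by (simp add: b dec_part_def)
  next
    case False
    then have "Poly_Mapping.keys ?\<gamma> = Poly_Mapping.keys \<beta>" using \<gamma> assms
      by (auto simp: in_keys_iff split: if_splits)
    then have "exponent_type ?\<gamma> = add_mset (Poly_Mapping.lookup ?\<gamma> i)
      (image_mset (Poly_Mapping.lookup \<beta>) (mset_set ?K))"
      by (simp add: exponent_type_def K img del: One_nat_def)
    then show ?thesis using False by (simp add: b dec_part_def \<gamma> del: One_nat_def)
  qed
qed

text \<open>The coefficient at \<beta> collects the coefficients of p at \<beta> divided by each
  variable occurring in it; summing over these variables is summing over the parts of the exponent
  type with multiplicity.\<close>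

lemma represents_e1_mult:
  assumes "represents N p f"
  shows "represents N (e1 N * p) (pieri f)"
  unfolding represents_def
proof
  fix \<beta>
  have e: "Poly_Mapping.lookup (e1 N * p) \<beta> =
      (\<Sum>i<N. if i \<in> Poly_Mapping.keys \<beta> then Poly_Mapping.lookup p (\<beta> - Poly_Mapping.single i 1)
        else 0)"
    by (simp add: e1_def sum_distrib_right lookup_sum lookup_Var_mult)
  have keys: "Poly_Mapping.keys (\<beta> - Poly_Mapping.single i 1) \<subseteq> {..<N} \<longleftrightarrow> Poly_Mapping.keys \<beta> \<subseteq>
    {..<N}" if "i < N" for i
    using that by (auto simp: subset_iff in_keys_iff lookup_minus lookup_single when_def split:
      if_splits)
  show "Poly_Mapping.lookup (e1 N * p) \<beta> = (if Poly_Mapping.keys \<beta> \<subseteq> {..<N} then pieri f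
    (exponent_type \<beta>) else 0)"
  proof (cases "Poly_Mapping.keys \<beta> \<subseteq> {..<N}")
    case True
    have "Poly_Mapping.lookup (e1 N * p) \<beta> =
        (\<Sum>i<N. if i \<in> Poly_Mapping.keys \<beta>
          then f (dec_part (Poly_Mapping.lookup \<beta> i) (exponent_type \<beta>)) else 0)"
      unfolding e using assms True keys
        by (intro sum.cong) (auto simp: represents_def exponent_type_dec simp del: One_nat_def)
    also have "\<dots> = (\<Sum>i\<in>Poly_Mapping.keys \<beta>. f (dec_part (Poly_Mapping.lookup \<beta> i)
      (exponent_type \<beta>)))"
      using True by (simp add: sum.If_cases Int_absorb1)
    also have "\<dots> = pieri f (exponent_type \<beta>)"
      by (simp add: pieri_def sum_unfold_sum_mset exponent_type_def multiset.map_comp comp_def)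
    finally show ?thesis using True by simp
  next
    case False
    then show ?thesis unfolding e using assms keys
      by (auto simp: represents_def intro!: sum.neutral simp del: One_nat_def)
  qed
qed

lemma represents_e1_pow_mult: "represents N p f \<Longrightarrow> represents N (e1 N ^ k * p) ((pieri ^^ k) f)"
  by (induction k) (auto simp: mult.assoc intro: represents_e1_mult)

lemma represents_lincomb:
  fixes c :: "'i \<Rightarrow> 'a::comm_ring_1"
  assumes "\<And>i. i \<in> I \<Longrightarrow> represents N (p i) (f i)"
  shows "represents N (\<Sum>i\<in>I. Const (c i) * p i) (\<lambda>M. \<Sum>i\<in>I. c i * f i M)"
proof -
  have "Poly_Mapping.lookup (Const a * q) \<alpha> = a * Poly_Mapping.lookup q \<alpha>"
    for a :: 'a and q :: "'a mpoly" and \<alpha>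
    unfolding Const_def using lookup_single_mult_add[of 0 a q \<alpha>] by simp
  then show ?thesis
    using assms by (auto simp: represents_def lookup_sum intro!: sum.cong sum.neutral)
qed

lemma represents_eqI:
  assumes "represents N p f" "represents N q g" "\<And>M. 0 \<notin># M \<Longrightarrow> f M = g M"
  shows "p = q"
  using assms zero_notin_exponent_type by (intro poly_mapping_eqI) (auto simp: represents_def)

section \<open>Monomial symmetric functions as coefficient functions\<close>

lemma mset_sort_desc: "mset (sort_desc xs) = filter_mset (\<lambda>a. a \<noteq> 0) (mset xs)"
  by (simp add: sort_desc_def)

lemma sort_desc_partition: "sort_desc xs \<in> partitions (sum_list xs)"
proof -
  have "sum_list (sort_desc xs) = sum_list xs"
  proof -
    have "\<Sum>\<^sub># (filter_mset (\<lambda>a. a \<noteq> 0) K) = \<Sum>\<^sub># K" for K :: "nat multiset"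
      by (induction K) auto
    then show ?thesis by (metis mset_sort_desc sum_mset_sum_list)
  qed
  then show ?thesis
    by (auto simp: partitions_def sort_desc_def sorted_wrt_rev)
qed

lemma lookup_nth_list:
  "Poly_Mapping.lookup (Poly_Mapping.nth xs) i = (if i < length xs then xs ! i else 0)"
  by (simp add: nth_default_def)

lemma keys_nth_subset: "Poly_Mapping.keys (Poly_Mapping.nth xs) \<subseteq> {..<length xs}"
  by (auto simp: in_keys_iff lookup_nth_list simp del: lookup_nth keys_nth split: if_splits)

lemma exponent_type_eq_filter:
  assumes "Poly_Mapping.keys \<beta> \<subseteq> {..<N}"
  shows "exponent_type \<beta> = filter_mset (\<lambda>a. a \<noteq> 0) (mset (map (Poly_Mapping.lookup \<beta>) [0..<N]))"
proof -
  have "Poly_Mapping.keys \<beta> = {i \<in> {0..<N}. Poly_Mapping.lookup \<beta> i \<noteq> 0}"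
    using assms by (auto simp: in_keys_iff)
  then show ?thesis
    by (simp add: exponent_type_def filter_mset_image_mset del: mset_upt flip:
      mset_set_upto_eq_mset_upto)
qed

lemma exponent_type_nth:
  assumes "0 \<notin> set xs"
  shows "exponent_type (Poly_Mapping.nth xs) = mset xs"
proof -
  have "map (Poly_Mapping.lookup (Poly_Mapping.nth xs)) [0..<length xs] = xs"
    by (intro nth_equalityI) (auto simp: lookup_nth_list simp del: lookup_nth)
  then show ?thesis
    using exponent_type_eq_filter[OF keys_nth_subset[of xs]] assms
    by (auto simp: filter_mset_eq_conv intro!: gr0I)
qed

text \<open>A partition of n \<le> N has at most N parts, so it is itself the exponent vector of a
  monomial in the N variables; compare the coefficients there.\<close>

lemma represents_eqD:
  assumes "represents N p f" "represents N p g" "\<kappa> \<in> partitions n" "n \<le> N"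
  shows "f (mset \<kappa>) = g (mset \<kappa>)"
proof -
  have "Poly_Mapping.keys (Poly_Mapping.nth \<kappa>) \<subseteq> {..<N}"
    using keys_nth_subset[of \<kappa>] length_partition[OF assms(3)] assms(4) by fastforce
  then show ?thesis
    using assms(1,2) exponent_type_nth[of \<kappa>] partitionsD(2)[OF assms(3)] unfolding represents_def
      by metis
qed

lemma prod_Var:
  assumes "length \<alpha> = N"
  shows "(\<Prod>i<N. Var i ^ (\<alpha> ! i)) = (Poly_Mapping.single (Poly_Mapping.nth \<alpha>) 1 :: 'a::comm_ring_1
    mpoly)"
proof -
  have pow: "Var i ^ k = (Poly_Mapping.single (Poly_Mapping.single i k) 1 :: 'a mpoly)" for i k
    by (induction k) (simp_all add: Var_def mult_single flip: single_add)
  have "(\<Prod>i<m. Var i ^ (\<alpha> ! i)) = (Poly_Mapping.single (\<Sum>i<m. Poly_Mapping.single i (\<alpha> ! i)) 1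
    :: 'a mpoly)" for m
    by (induction m) (simp_all add: pow mult_single add.commute)
  moreover have "(\<Sum>i<N. Poly_Mapping.single i (\<alpha> ! i)) = Poly_Mapping.nth \<alpha>"
    using assms by (intro poly_mapping_eqI)
      (auto simp: lookup_sum lookup_single when_def lookup_nth_list simp del: lookup_nth)
  ultimately show ?thesis by simp
qed

text \<open>The exponent list b is the only one of length N that yields the monomial \<beta>, so at
  most one summand contributes.\<close>

lemma represents_msym:
  assumes lam: "lam \<in> partitions n"
  shows "represents N (msym N lam) (\<delta> (mset lam))"
  unfolding represents_def
proof
  fix \<beta> :: "nat \<Rightarrow>\<^sub>0 nat"
  define A where "A = {\<alpha>. length \<alpha> = N \<and> sort_desc \<alpha> = lam}"
  define b where "b = map (Poly_Mapping.lookup \<beta>) [0..<N]"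
  have "A \<subseteq> {\<alpha>. set \<alpha> \<subseteq> insert 0 (set lam) \<and> length \<alpha> = N}"
    by (auto simp: A_def sort_desc_def)
  \<comment> \<open>An infinite index set would give the sum its default value 0.\<close>
  then have fin: "finite A"
    by (rule finite_subset) (simp add: finite_lists_length_eq)
  have "Poly_Mapping.lookup (msym N lam :: 'a mpoly) \<beta> = (\<Sum>\<alpha>\<in>A. of_bool (Poly_Mapping.nth \<alpha> = \<beta>))"
    unfolding msym_def lookup_sum A_def[symmetric]
    by (intro sum.cong) (auto simp: A_def prod_Var lookup_single)
  also have "\<dots> = (if Poly_Mapping.keys \<beta> \<subseteq> {..<N} then \<delta> (mset lam) (exponent_type \<beta>) else 0)"
  proof (cases "Poly_Mapping.keys \<beta> \<subseteq> {..<N}")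
    case True
    have "Poly_Mapping.nth \<alpha> = \<beta> \<longleftrightarrow> \<alpha> = b" if "length \<alpha> = N" for \<alpha>
    proof
      assume "Poly_Mapping.nth \<alpha> = \<beta>"
      then show "\<alpha> = b" using that
        by (intro nth_equalityI) (auto simp: b_def lookup_nth_list simp del: lookup_nth)
    next
      assume "\<alpha> = b"
      then show "Poly_Mapping.nth \<alpha> = \<beta>" using True
        by (intro poly_mapping_eqI) (auto simp: b_def lookup_nth_list in_keys_iff simp del:
          lookup_nth)
    qed
    then have "(\<Sum>\<alpha>\<in>A. of_bool (Poly_Mapping.nth \<alpha> = \<beta>)) = (\<Sum>\<alpha>\<in>A. if \<alpha> = b then 1 else 0 :: 'a)"
      by (intro sum.cong) (auto simp: A_def)
    also have "\<dots> = of_bool (b \<in> A)" using fin by simp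
    also have "b \<in> A \<longleftrightarrow> exponent_type \<beta> = mset lam"
    proof -
      have "exponent_type \<beta> = mset (sort_desc b)"
        using exponent_type_eq_filter[OF True] by (simp add: b_def mset_sort_desc)
      moreover have "length b = N" by (simp add: b_def)
      ultimately show ?thesis
        using partitions_mset_inj[OF sort_desc_partition lam] by (auto simp: A_def)
    qed
    finally show ?thesis using True by (simp add: \<delta>_def)
  next
    case False
    then have "Poly_Mapping.nth \<alpha> \<noteq> \<beta>" if "\<alpha> \<in> A" for \<alpha>
      using that keys_nth_subset[of \<alpha>] by (auto simp: A_def simp del: keys_nth)
    then show ?thesis using False by simp
  qed
  finally show "Poly_Mapping.lookup (msym N lam) \<beta> = (if Poly_Mapping.keys \<beta> \<subseteq> {..<N} then \<delta>
    (mset lam) (exponent_type \<beta>) else 0 :: 'a)" .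
qed

section \<open>Coefficients of powers of e_1 times a monomial function\<close>

lemma homog_expand:
  assumes "homog n f" "0 \<notin># M"
  shows "f M = (\<Sum>\<kappa>\<in>partitions n. f (mset \<kappa>) * \<delta> (mset \<kappa>) M)"
proof (cases "\<Sum>\<^sub># M = n")
  case True
  then obtain \<kappa> where \<kappa>: "\<kappa> \<in> partitions n" "mset \<kappa> = M"
    using partition_of_mset[OF assms(2)] by blast
  then have "(\<Sum>\<kappa>'\<in>partitions n. f (mset \<kappa>') * \<delta> (mset \<kappa>') M) =
    (\<Sum>\<kappa>'\<in>partitions n. if \<kappa>' = \<kappa> then f M else 0)"
    by (intro sum.cong) (auto simp: \<delta>_def dest: partitions_mset_inj)
  then show ?thesis using \<kappa> by (simp add: finite_partitions)
next
  case False
  then have "f M = 0" using homogD[OF assms(1)] by blast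
  moreover have "M \<noteq> mset \<kappa>" if "\<kappa> \<in> partitions n" for \<kappa>
    using False partitionsD(3)[OF that] by (metis sum_mset_sum_list)
  ultimately show ?thesis by (simp add: \<delta>_def)
qed

lemma homog_mset_partition: "\<nu> \<in> partitions m \<Longrightarrow> homog m (\<delta> (mset \<nu>))"
  using homog_\<delta>[of "mset \<nu>"] by (auto simp: partitions_def sum_mset_sum_list)

text \<open>The \<open>THE\<close> is resolved by \<open>homog_expand\<close> for existence. For
  uniqueness, evaluation at \<open>mset \<kappa>\<close> in n variables isolates the coefficient of
  \<kappa>, and outside \<open>partitions n\<close> the value is prescribed to be 0.\<close>

lemma e1_coeff_eq:
  assumes lam: "lam \<in> partitions n" and nu: "\<nu> \<in> partitions m"
  shows "(e1_coeff lam \<nu> :: 'a::comm_ring_1) =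
    (if n < m then 0 else (pieri ^^ (n - m)) (\<delta> (mset \<nu>)) (mset lam))"
proof (cases "n < m")
  case True
  then show ?thesis using partitionsD(3)[OF lam] partitionsD(3)[OF nu] by (simp add: e1_coeff_def)
next
  case False
  define f :: "nat multiset \<Rightarrow> 'a" where "f = (pieri ^^ (n - m)) (\<delta> (mset \<nu>))"
  define c where "c \<kappa> = (if \<kappa> \<in> partitions n then f (mset \<kappa>) else 0)" for \<kappa>
  have hom: "homog n f"
    using homog_pieri_pow[OF homog_mset_partition[OF nu], of "n - m"] False by (simp add: f_def)
  have rep1: "represents N (e1 N ^ (n - m) * msym N \<nu>) f" for N
    unfolding f_def by (intro represents_e1_pow_mult represents_msym[OF nu])
  have rep2: "represents N (\<Sum>\<kappa>\<in>partitions n. Const (d \<kappa>) * msym N \<kappa>)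
      (\<lambda>M. \<Sum>\<kappa>\<in>partitions n. d \<kappa> * \<delta> (mset \<kappa>) M)" for N and d :: "nat list \<Rightarrow> 'a"
    by (rule represents_lincomb) (rule represents_msym)
  have "(THE c. (\<forall>\<kappa>. \<kappa> \<notin> partitions n \<longrightarrow> c \<kappa> = 0) \<and>
     (\<forall>N \<ge> n. e1 N ^ (n - m) * msym N \<nu> = (\<Sum>\<kappa> \<in> partitions n. Const (c \<kappa>) * msym N \<kappa>))) = c"
  proof (intro the_equality conjI allI impI)
    fix N
    show "e1 N ^ (n - m) * msym N \<nu> = (\<Sum>\<kappa> \<in> partitions n. Const (c \<kappa>) * msym N \<kappa>)"
      using rep1 rep2 by (rule represents_eqI) (simp add: homog_expand[OF hom] c_def)
  next
    fix d assume d: "(\<forall>\<kappa>. \<kappa> \<notin> partitions n \<longrightarrow> d \<kappa> = (0::'a)) \<and>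
     (\<forall>N \<ge> n. e1 N ^ (n - m) * msym N \<nu> = (\<Sum>\<kappa> \<in> partitions n. Const (d \<kappa>) * msym N \<kappa>))"
    show "d = c"
    proof
      fix \<kappa>
      show "d \<kappa> = c \<kappa>"
      proof (cases "\<kappa> \<in> partitions n")
        case True
        have "f (mset \<kappa>) = (\<Sum>\<kappa>'\<in>partitions n. d \<kappa>' * \<delta> (mset \<kappa>') (mset \<kappa>))"
          using d rep1[of n] rep2[of n d] by (intro represents_eqD[OF _ _ True, of n]) auto
        also have "\<dots> = (\<Sum>\<kappa>'\<in>partitions n. if \<kappa>' = \<kappa> then d \<kappa> else 0)"
          using True by (intro sum.cong) (auto simp: \<delta>_def dest: partitions_mset_inj)
        finally show ?thesis using True by (simp add: c_def finite_partitions)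
      qed (use d in \<open>simp add: c_def\<close>)
    qed
  qed (simp add: c_def)
  then show ?thesis using False lam partitionsD(3)[OF lam] partitionsD(3)[OF nu]
    by (simp add: e1_coeff_def c_def f_def)
qed

subsection \<open>Uniqueness of the expansion\<close>

text \<open>In k steps a part drops by at most k, so m stays above r, which bounds the parts of
  K.\<close>

lemma pieri_pow_\<delta>_eq_0:
  fixes M :: "nat multiset"
  assumes "\<forall>x\<in>#K. x \<le> r"
  shows "m \<in># M \<Longrightarrow> m > r + k \<Longrightarrow> (pieri ^^ k) (\<delta> K) M = (0 :: 'a::comm_ring_1)"
proof (induction k arbitrary: m M)
  case 0
  then show ?case using assms by (auto simp: \<delta>_def)
next
  case (Suc k)
  have "(pieri ^^ k) (\<delta> K) (dec_part x M) = (0::'a)" if "x \<in># M" for x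
  proof (cases "x = m")
    case True
    have "m - 1 \<in># dec_part x M" using True Suc.prems by (simp add: dec_part_def)
    then show ?thesis by (rule Suc.IH) (use Suc.prems in simp)
  next
    case False
    then have "m \<in># dec_part x M" using Suc.prems by (simp add: dec_part_def in_diff_count)
    then show ?thesis by (rule Suc.IH) (use Suc.prems in simp)
  qed
  then have "image_mset (\<lambda>x. (pieri ^^ k) (\<delta> K) (dec_part x M)) M = image_mset (\<lambda>_. 0::'a) M"
    by (intro image_mset_cong) auto
  then show ?case by (simp add: pieri_def[of "(pieri ^^ k) (\<delta> K)"])
qed

text \<open>All k steps are spent on bringing the part r + k down to r. There is one way to do so,
  and the other parts must already agree with those of K.\<close>

lemma pieri_pow_\<delta>_top:
  assumes "is_top r K"
  shows "is_top (r + k) M \<Longrightarrow>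
    (pieri ^^ k) (\<delta> K) M = (of_bool (M - {#r + k#} = K - {#r#}) :: 'a::comm_ring_1)"
proof (induction k arbitrary: M)
  case 0
  then have "M = K \<longleftrightarrow> M - {#r#} = K - {#r#}"
  proof (cases "r = 0")
    case False
    then have "r \<in># M" "r \<in># K" using 0 assms by (auto simp: is_top_def)
    then show ?thesis by (metis insert_DiffM)
  qed (use 0 assms in simp)
  then show ?case by (simp add: \<delta>_def)
next
  case (Suc k)
  define m where "m = r + Suc k"
  have le: "\<forall>x\<in>#K. x \<le> r" using assms by (simp add: is_top_def)
  have "m \<in># M" using Suc.prems by (simp add: is_top_def m_def)
  then obtain M' where M: "M = add_mset m M'" by (blast dest: multi_member_split)
  have M': "0 \<notin># M'" "\<forall>x\<in>#M'. x \<le> m" using Suc.prems by (auto simp: is_top_def M m_def)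
  \<comment> \<open>Lowering another part leaves m = r + k + 1 in place with only k steps to
    go.\<close>
  have "(pieri ^^ k) (\<delta> K) (dec_part x M) = (0::'a)" if "x \<in># M'" for x
    using that le by (intro pieri_pow_\<delta>_eq_0[of K r m]) (auto simp: M dec_part_add m_def)
  then have "image_mset (\<lambda>x. (pieri ^^ k) (\<delta> K) (dec_part x M)) M' = image_mset (\<lambda>_. 0::'a) M'"
    by (intro image_mset_cong) auto
  then have "(pieri ^^ Suc k) (\<delta> K) M = ((pieri ^^ k) (\<delta> K) (dec_part m M) :: 'a)"
    by (simp add: pieri_def[of "(pieri ^^ k) (\<delta> K)"] M)
  also have "\<dots> = of_bool (M' = K - {#r#})"
  proof (cases "m \<in># M'")
    \<comment> \<open>A second copy of m survives the lowering, so the left side vanishes; so does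
      the right side, as K has no part above r.\<close>
    case True
    then have "m \<in># dec_part m M" by (simp add: M dec_part_same)
    then have "(pieri ^^ k) (\<delta> K) (dec_part m M) = (0::'a)"
      by (rule pieri_pow_\<delta>_eq_0[OF le]) (simp add: m_def)
    moreover have "M' \<noteq> K - {#r#}"
    proof
      assume "M' = K - {#r#}"
      then have "m \<in># K" using True by (metis in_diffD)
      then show False using le by (fastforce simp: m_def)
    qed
    ultimately show ?thesis by simp
  next
    case False
    then have "\<forall>x\<in>#M'. x \<le> r + k" using M'(2) by (metis add_Suc_right le_Suc_eq m_def)
    then have "is_top (r + k) (dec_part m M)"
      using M' by (cases "r + k = 0") (auto simp: M dec_part_same is_top_def m_def)
    moreover have "dec_part m M - {#r + k#} = M'"
    proof (cases "r + k = 0")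
      case True
      then have "M' = {#}" using M' False \<open>\<forall>x\<in>#M'. x \<le> r + k\<close>
        by (metis le_zero_eq multiset_nonemptyE)
      then show ?thesis using True by (simp add: M dec_part_same m_def)
    qed (auto simp: M dec_part_same m_def)
    ultimately show ?thesis using Suc.IH by simp
  qed
  finally show ?case by (simp add: M m_def)
qed

text \<open>The parts occurring in \<open>mtilde\<close> for \<kappa> reach at most \<kappa>_2 +
  (\<kappa>_1 - \<kappa>_2) = \<kappa>_1, and if the top is \<kappa>_1 the remaining parts are those
  of \<open>tl \<kappa>\<close>.\<close>

lemma pieri_pow_mtilde_index_triangular:
  assumes \<kappa>: "\<kappa> \<in> partitions n" and \<kappa>': "\<kappa>' \<in> partitions n" and n: "n \<ge> 1"
    and le: "part \<kappa> 1 \<le> part \<kappa>' 1"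
  shows "mtilde_coeff \<kappa> (mset \<kappa>') = (of_bool (\<kappa> = \<kappa>') :: 'a::comm_ring_1)"
proof -
  have top: "is_top (part \<kappa> 2) (mtilde_index \<kappa>)" and tl: "mtilde_index \<kappa> - {#part \<kappa> 2#} =
    mset (tl \<kappa>)"
    using mtilde_index_props[OF \<kappa>] by auto
  have eq: "part \<kappa> 2 + (part \<kappa> 1 - part \<kappa> 2) = part \<kappa> 1"
    using part_2_le[OF \<kappa>] by simp
  obtain k ks where k: "\<kappa> = k # ks" using partition_nonempty[OF \<kappa> n] by (cases \<kappa>) auto
  obtain k' ks' where k': "\<kappa>' = k' # ks'" using partition_nonempty[OF \<kappa>' n] by (cases \<kappa>') auto
  have 1: "part \<kappa> 1 = k" "part \<kappa>' 1 = k'" by (simp_all add: k k' Defs.part_def)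
  show ?thesis
  proof (cases "k < k'")
    case True
    have "mtilde_coeff \<kappa> (mset \<kappa>') = (0::'a)"
    proof (rule pieri_pow_\<delta>_eq_0)
      show "\<forall>x\<in>#mtilde_index \<kappa>. x \<le> part \<kappa> 2" using top by (simp add: is_top_def)
      show "k' \<in># mset \<kappa>'" by (simp add: k')
      show "part \<kappa> 2 + (part \<kappa> 1 - part \<kappa> 2) < k'" using eq 1 True by simp
    qed
    then show ?thesis using True by (auto simp: k k')
  next
    case False
    then have kk: "k = k'" using le 1 by simp
    then have eq': "part \<kappa> 2 + (part \<kappa> 1 - part \<kappa> 2) = k'" using eq 1 by simp
    have "is_top (part \<kappa> 2 + (part \<kappa> 1 - part \<kappa> 2)) (mset \<kappa>')"
      unfolding eq' using partitionsD[OF \<kappa>'] by (auto simp: k' is_top_def)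
    from pieri_pow_\<delta>_top[OF top this]
    have "mtilde_coeff \<kappa> (mset \<kappa>') = (of_bool (mset ks' = mset ks) :: 'a)"
      unfolding eq' tl by (simp add: k' k)
    moreover have "mset ks' = mset ks \<longleftrightarrow> \<kappa> = \<kappa>'"
      using partitions_mset_inj[OF \<kappa> \<kappa>'] by (auto simp: k k' kk)
    ultimately show ?thesis by simp
  qed
qed

text \<open>Among the indices with nonzero coefficient take \<mu> with the largest first part.
  Evaluated at \<mu>, the vanishing combination reduces to \<open>d \<mu>\<close> by
  triangularity.\<close>

lemma mtilde_index_independent:
  fixes d :: "nat list \<Rightarrow> 'a::comm_ring_1"
  assumes n: "n \<ge> 1"
    and zero: "\<And>\<kappa>'. \<kappa>' \<in> partitions n \<Longrightarrow>
      (\<Sum>\<kappa>\<in>partitions n. d \<kappa> * mtilde_coeff \<kappa> (mset \<kappa>')) = 0"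
    and "\<kappa>\<^sub>0 \<in> partitions n"
  shows "d \<kappa>\<^sub>0 = 0"
proof (rule ccontr)
  assume "d \<kappa>\<^sub>0 \<noteq> 0"
  define S where "S = {\<kappa> \<in> partitions n. d \<kappa> \<noteq> 0}"
  have S: "finite S" "S \<noteq> {}"
    using finite_partitions[of n] assms(3) \<open>d \<kappa>\<^sub>0 \<noteq> 0\<close> by (auto simp: S_def)
  then have "Max ((\<lambda>\<kappa>. part \<kappa> 1) ` S) \<in> (\<lambda>\<kappa>. part \<kappa> 1) ` S"
    by (intro Max_in) auto
  then obtain \<mu> where \<mu>: "\<mu> \<in> S" "part \<mu> 1 = Max ((\<lambda>\<kappa>. part \<kappa> 1) ` S)" by (metis imageE)
  have max: "part \<kappa> 1 \<le> part \<mu> 1" if "\<kappa> \<in> S" for \<kappa>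
    unfolding \<mu>(2) using S that by (intro Max_ge) auto
  have "(\<Sum>\<kappa>\<in>partitions n. d \<kappa> * mtilde_coeff \<kappa> (mset \<mu>)) =
      (\<Sum>\<kappa>\<in>partitions n. if \<kappa> = \<mu> then d \<mu> else 0)"
  proof (intro sum.cong refl)
    fix \<kappa> assume \<kappa>: "\<kappa> \<in> partitions n"
    show "d \<kappa> * mtilde_coeff \<kappa> (mset \<mu>) = (if \<kappa> = \<mu> then d \<mu> else 0)"
    proof (cases "d \<kappa> = 0")
      case False
      then have "mtilde_coeff \<kappa> (mset \<mu>) = (of_bool (\<kappa> = \<mu>) :: 'a)"
        using \<kappa> \<mu>(1) max n by (intro pieri_pow_mtilde_index_triangular) (auto simp: S_def)
      then show ?thesis by auto
    qed auto
  qed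
  also have "\<dots> = d \<mu>" using \<mu>(1) by (simp add: S_def finite_partitions)
  finally show False using zero[of \<mu>] \<mu>(1) by (simp add: S_def)
qed

section \<open>Identification of the transition matrix\<close>

lemma represents_mtilde:
  assumes "\<kappa> \<in> partitions n"
  shows "represents N (mtilde N \<kappa>) (mtilde_coeff \<kappa>)"
proof -
  have "mset (sort_desc (part \<kappa> 2 # tl \<kappa>)) = mtilde_index \<kappa>"
    using partitionsD[OF assms]
    by (cases \<kappa>; cases "tl \<kappa>")
      (auto simp: mset_sort_desc mtilde_index_def Defs.part_def filter_mset_eq_conv intro!: gr0I)
  then show ?thesis
    unfolding mtilde_def using represents_msym[OF sort_desc_partition]
      by (metis represents_e1_pow_mult)
qed

text \<open>Existence is \<open>delta_expand\<close>, transferred to polynomials by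
  \<open>represents_eqI\<close>. For uniqueness, the difference of two expansions in n variables is
  a vanishing combination as in \<open>mtilde_index_independent\<close>.\<close>

lemma trans_mat_eq:
  assumes lam: "lam \<in> partitions n" and mu: "\<mu> \<in> partitions n" and n: "n \<ge> 1"
  shows "(trans_mat \<mu> lam :: 'a::comm_ring_1) = trans_coeff lam \<mu>"
proof -
  define c :: "nat list \<Rightarrow> 'a" where "c \<kappa> = (if \<kappa> \<in> partitions n then trans_coeff lam \<kappa> else 0)"
    for \<kappa>
  have represents: "represents N (\<Sum>\<kappa>\<in>partitions n. Const (d \<kappa>) * mtilde N \<kappa>)
      (\<lambda>M. \<Sum>\<kappa>\<in>partitions n. d \<kappa> * mtilde_coeff \<kappa> M)" for N and d :: "nat list \<Rightarrow> 'a"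
    by (rule represents_lincomb) (rule represents_mtilde)
  have exp: "\<delta> (mset lam) M = (\<Sum>\<kappa>\<in>partitions n. c \<kappa> * mtilde_coeff \<kappa> M)" for M
    unfolding delta_expand[OF lam n] by (simp add: c_def)
  have "(THE c. (\<forall>\<kappa>. \<kappa> \<notin> partitions n \<longrightarrow> c \<kappa> = 0) \<and>
     (\<forall>N \<ge> n. msym N lam = (\<Sum>\<kappa> \<in> partitions n. Const (c \<kappa>) * mtilde N \<kappa>))) = c"
  proof (intro the_equality conjI allI impI)
    fix N
    show "msym N lam = (\<Sum>\<kappa> \<in> partitions n. Const (c \<kappa>) * mtilde N \<kappa>)"
      using represents_msym[OF lam] represents by (rule represents_eqI) (rule exp)
  next
    fix d assume d: "(\<forall>\<kappa>. \<kappa> \<notin> partitions n \<longrightarrow> d \<kappa> = (0::'a)) \<and>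
     (\<forall>N \<ge> n. msym N lam = (\<Sum>\<kappa> \<in> partitions n. Const (d \<kappa>) * mtilde N \<kappa>))"
    show "d = c"
    proof
      fix \<kappa>
      show "d \<kappa> = c \<kappa>"
      proof (cases "\<kappa> \<in> partitions n")
        case True
        have "d \<kappa> - c \<kappa> = 0"
        proof (rule mtilde_index_independent[OF n _ True])
          fix \<kappa>' assume "\<kappa>' \<in> partitions n"
          moreover have "represents n (msym n lam)
              (\<lambda>M. \<Sum>\<kappa>\<in>partitions n. d \<kappa> * mtilde_coeff \<kappa> M)"
            using d represents[of n d] by simp
          ultimately have "\<delta> (mset lam) (mset \<kappa>') =
              (\<Sum>\<kappa>\<in>partitions n. d \<kappa> * mtilde_coeff \<kappa> (mset \<kappa>'))"
            by (intro represents_eqD[OF represents_msym[OF lam]]) auto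
          then show "(\<Sum>\<kappa>\<in>partitions n. (d \<kappa> - c \<kappa>) *
              mtilde_coeff \<kappa> (mset \<kappa>')) = 0"
            unfolding exp by (simp add: left_diff_distrib sum_subtractf)
        qed
        then show ?thesis by simp
      qed (use d in \<open>simp add: c_def\<close>)
    qed
  qed (simp add: c_def)
  then show ?thesis using mu by (simp add: trans_mat_def partitionsD(3)[OF lam] c_def)
qed

section \<open>Rewriting the entries with binomials, signs and the coefficients
  \<open>e1_coeff\<close>\<close>

theorem theorem1:
  fixes n :: nat and lam \<mu> :: "nat list"
  assumes "n \<ge> 1" and "\<mu> \<in> partitions n" and "lam \<in> partitions n"
  shows "(trans_mat \<mu> lam :: 'a::field_char_0) =
    (-1) powi (int (part lam 1) - int (part \<mu> 1)) *
      (of_nat (binom (int (part lam 1) - int (part \<mu> 2)) (part \<mu> 1 - part \<mu> 2)) *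
         e1_coeff (tl \<mu>) (tl lam) +
       of_nat (binom (int (part lam 1) - int (part \<mu> 2) - 1) (part \<mu> 1 - part \<mu> 2)) *
         e1_coeff (sort_desc ((part \<mu> 2 - 1) # tl (tl \<mu>))) (tl lam))"
proof -
  define a k1 k2 where "a = part lam 1" and "k1 = part \<mu> 1" and "k2 = part \<mu> 2"
  define h :: "nat multiset \<Rightarrow> 'a" where "h = \<delta> (mset (tl lam))"
  define \<sigma> where "\<sigma> = sort_desc ((k2 - 1) # tl (tl \<mu>))"
  have le: "k2 \<le> k1" "k1 \<le> n" "a \<le> n"
    using part_2_le part_le assms by (auto simp: a_def k1_def k2_def simp del: One_nat_def)
  have "a > 0"
    using assms(1,3) by (cases lam) (auto simp: a_def Defs.part_def partitions_def)
  \<comment> \<open>The sizes of \<open>tl \<mu>\<close> and \<open>tl lam\<close> are n - k1 and n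
    - a.\<close>
  have E1: "e1_coeff (tl \<mu>) (tl lam) = (if k1 \<le> a then (pieri ^^ (a - k1)) h (mset (tl \<mu>))
    else 0)"
  proof -
    have "n - k1 - (n - a) = a - k1" "n - k1 < n - a \<longleftrightarrow> \<not> k1 \<le> a" using le by auto
    then show ?thesis
      using e1_coeff_eq[OF tl_partition[OF assms(2)] tl_partition[OF assms(3)], where 'a = 'a]
      by (simp add: h_def flip: a_def k1_def del: One_nat_def)
  qed
  \<comment> \<open>Lowering one copy of k2 in \<open>tl \<mu>\<close> gives the parts of \<sigma>,
    whose size is n - k1 - 1.\<close>
  have E2: "e1_coeff \<sigma> (tl lam) =
    (if k1 < a then (pieri ^^ (a - 1 - k1)) h (dec_part k2 (mset (tl \<mu>))) else 0)" if "k2 > 0"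
  proof -
    have tl: "tl \<mu> = k2 # tl (tl \<mu>)"
      using that by (cases \<mu>; cases "tl \<mu>") (auto simp: k2_def Defs.part_def)
    have "0 \<notin> set (tl (tl \<mu>))"
      using partitionsD(2)[OF assms(2)] by (cases \<mu>; cases "tl \<mu>") auto
    then have "filter_mset (\<lambda>a. a \<noteq> 0) (mset (tl (tl \<mu>))) = mset (tl (tl \<mu>))"
      by (auto simp: filter_mset_eq_conv intro!: gr0I)
    moreover have "dec_part k2 (mset (tl \<mu>)) = dec_part k2 (add_mset k2 (mset (tl (tl \<mu>))))"
      by (subst tl) simp
    ultimately have m: "mset \<sigma> = dec_part k2 (mset (tl \<mu>))"
      using that by (simp add: \<sigma>_def mset_sort_desc dec_part_same)
    have "sum_list (tl \<mu>) = n - k1"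
      using partitionsD(3)[OF tl_partition[OF assms(2)]] by (simp add: k1_def)
    then have "k2 + sum_list (tl (tl \<mu>)) = n - k1"
      by (subst (asm) tl) simp
    then have s: "sum_list ((k2 - 1) # tl (tl \<mu>)) = n - k1 - 1" and pos: "n - k1 \<ge> 1"
      using that by auto
    have "\<sigma> \<in> partitions (n - k1 - 1)"
      using sort_desc_partition[of "(k2 - 1) # tl (tl \<mu>)"] unfolding s \<sigma>_def .
    moreover have "n - k1 - 1 - (n - a) = a - 1 - k1" "n - k1 - 1 < n - a \<longleftrightarrow> \<not> k1 < a"
      using le pos by auto
    ultimately show ?thesis
      using e1_coeff_eq[OF _ tl_partition[OF assms(3)], where 'a = 'a and lam = \<sigma>]
      by (simp add: h_def m flip: a_def del: One_nat_def)
  qed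
  \<comment> \<open>For a < k1 both terms of the formula vanish, whatever the value of the negative
    power.\<close>
  have sign: "(-1) powi (int a - int k1) = ((-1) ^ (a - k1) :: 'a)" if "k1 \<le> a"
    using that by (simp add: power_int_def nat_diff_distrib flip: of_nat_diff)
  \<comment> \<open>Binomial symmetry, since (a - k2) - (k1 - k2) = a - k1.\<close>
  have B1: "binom (int a - int k2) (k1 - k2) = (a - k2) choose (a - k1)" if "k1 \<le> a"
  proof -
    have "nat (int a - int k2) = a - k2" by simp
    moreover have "(a - k2) choose (k1 - k2) = (a - k2) choose (a - k1)"
      using binomial_symmetric[of "k1 - k2" "a - k2"] that le by simp
    ultimately show ?thesis using that le by (simp add: binom_def)
  qed
  have B2: "binom (int a - int k2 - 1) (k1 - k2) = (a - 1 - k2) choose (a - 1 - k1)" if "k1 < a"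
  proof -
    have "nat (int a - int k2 - 1) = a - 1 - k2" by simp
    moreover have "(a - 1 - k2) choose (k1 - k2) = (a - 1 - k2) choose (a - 1 - k1)"
      using binomial_symmetric[of "k1 - k2" "a - 1 - k2"] that le by simp
    ultimately show ?thesis using that le by (simp add: binom_def)
  qed
  \<comment> \<open>Here \<mu> = (n), and truncated subtraction makes \<sigma> empty, so its
    \<open>e1_coeff\<close> can be nonzero. The term is removed by its binomial coefficient, because
    a - 1 < n.\<close>
  have B2': "binom (int a - int k2 - 1) (k1 - k2) = 0" if "k2 = 0"
  proof -
    have "tl \<mu> = []"
      using that partitionsD(2)[OF assms(2)] by (cases \<mu>; cases "tl \<mu>")
        (auto simp: k2_def Defs.part_def)
    then have "k1 = n"
      using partitionsD(3)[OF assms(2)] assms(1) by (cases \<mu>) (auto simp: k1_def Defs.part_def)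
    moreover have "nat (int a - 1) < n" using le \<open>a > 0\<close> by auto
    ultimately show ?thesis using that by (simp add: binom_def)
  qed
  \<comment> \<open>The exponents differ by one, which turns the minus in \<open>trans_coeff\<close>
    into the plus of the formula.\<close>
  have sign2: "(-1) ^ (a - k1) = - ((-1) ^ (a - 1 - k1) :: 'a)" if "k1 < a"
  proof -
    have "a - k1 = Suc (a - 1 - k1)" using that by simp
    then show ?thesis by simp
  qed
  have trans_coeff: "(trans_coeff lam \<mu> :: 'a) =
     (if k1 \<le> a then (-1) ^ (a - k1) * of_nat ((a - k2) choose (a - k1)) * (pieri ^^ (a - k1)) h
       (mset (tl \<mu>)) else 0) -
     (if k1 < a \<and> k2 > 0 then (-1) ^ (a - 1 - k1) * of_nat ((a - 1 - k2) choose (a - 1 - k1)) *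
        (pieri ^^ (a - 1 - k1)) h (dec_part k2 (mset (tl \<mu>))) else 0)"
    unfolding trans_coeff_def Let_def a_def k1_def k2_def h_def ..
  have "trans_coeff lam \<mu> = (-1) powi (int a - int k1) *
      (of_nat (binom (int a - int k2) (k1 - k2)) * e1_coeff (tl \<mu>) (tl lam) +
       of_nat (binom (int a - int k2 - 1) (k1 - k2)) * (e1_coeff \<sigma> (tl lam) :: 'a))"
  proof (cases "k2 = 0")
    case True
    then show ?thesis unfolding trans_coeff using E1 B1 B2' sign by (simp add: mult.assoc)
  next
    case False
    consider "k1 < a" | "k1 = a" | "a < k1" by linarith
    then show ?thesis
    proof cases
      case 1
      then show ?thesis unfolding trans_coeff using False E1 E2 B1 B2 sign sign2
        by (simp add: distrib_left mult.assoc del: One_nat_def)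
    next
      case 2
      \<comment> \<open>For k1 = a the size of \<sigma> is one less than that of
        \<open>tl lam\<close>, so the second term is 0 on both sides.\<close>
      then show ?thesis unfolding trans_coeff using False E1 E2 B1 sign by simp
    next
      case 3
      then show ?thesis unfolding trans_coeff using False E1 E2 by simp
    qed
  qed
  then show ?thesis
    unfolding trans_mat_eq[OF assms(3,2,1)] a_def k1_def k2_def \<sigma>_def .
qed

end
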